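(* For every integer $n\ge 1$, the clique complex $K_n$ of the partition graph $G_n$ is homotopy equivalent to a wedge of $2$-spheres: $$K_n\simeq \bigvee^{\,b_n} S^2,\qquad b_n=\chi(K_n)-1,$$ where $\chi(K_n)$ is the Euler characteristic of $K_n$ (and the wedge of $0$ spheres is a point).
   Context: A partition of a positive integer $n$ is a weakly decreasing sequence $\lambda=(\lambda_1\ge\cdots\ge\lambda_\ell>0)$ of positive integers with sum $n$; it is identified with its Ferrers diagram, the left-justified array with $\lambda_i$ cells in row $i$. The partition graph $G_n$ is the simple graph whose vertices are all partitions of $n$; two distinct partitions are adjacent if one can be obtained from the other by removing one cell from a row of the Ferrers diagram, adding it to another row (possibly a new row, i.e. a row of length $0$), and then reordering the row lengths into weakly decreasing order (discarding zeros). $K_n:=\mathrm{Cl}(G_n)$ is the clique complex of $G_n$: the simplicial complex whose simplices are the finite nonempty cliques of $G_n$. *)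

theory Defs
  imports "HOL-Analysis.Analysis" "HOL-Library.Ramsey"
begin

section \<open>The partition graph\<close>

definition partitions :: "nat \<Rightarrow> nat list set" where
  "partitions n = {xs. sorted_wrt (\<ge>) xs \<and> (\<forall>k\<in>set xs. 0 < k) \<and> sum_list xs = n}"

lemma finite_partitions: "finite (partitions n)"
proof (rule finite_subset)
  have len: "length xs \<le> sum_list xs" if "\<forall>k\<in>set xs. 0 < k" for xs :: "nat list"
    using that by (induction xs) auto
  show "partitions n \<subseteq> {xs. set xs \<subseteq> {..n} \<and> length xs \<le> n}"
    using len by (auto simp: partitions_def intro: member_le_sum_list)
  show "finite {xs :: nat list. set xs \<subseteq> {..n} \<and> length xs \<le> n}"
    by (rule finite_lists_length_le) simp
qed

text \<open>Rows are indexed from 0.  The appended entry 0 is the possible new row, so the target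
  index \<open>j\<close> may be \<open>length xs\<close>.  Meant for \<open>i < length xs\<close>, \<open>j \<le> length xs\<close> and \<open>i \<noteq> j\<close>.\<close>

definition move_cell :: "nat list \<Rightarrow> nat \<Rightarrow> nat \<Rightarrow> nat list" where
  "move_cell xs i j =
    (let ys = xs @ [0]
     in rev (sort (filter (\<lambda>k. 0 < k) (ys[i := ys ! i - 1, j := ys ! j + 1]))))"

text \<open>Edges are unordered pairs, so it is enough that one of the two partitions arises
  from the other.\<close>

definition partition_edges :: "nat \<Rightarrow> nat list set set" where
  "partition_edges n =
    {{xs, ys} |xs ys. xs \<in> partitions n \<and> ys \<in> partitions n \<and> xs \<noteq> ys \<and>
       (\<exists>i j. i < length xs \<and> j \<le> length xs \<and> i \<noteq> j \<and> ys = move_cell xs i j)}"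


section \<open>Abstract simplicial complexes\<close>

text \<open>A complex is given by its set of nonempty simplices, each a finite set of vertices.\<close>

definition clique_complex :: "'a set \<Rightarrow> 'a set set \<Rightarrow> 'a set set" where
  "clique_complex V E = {\<sigma>. \<sigma> \<subseteq> V \<and> finite \<sigma> \<and> \<sigma> \<noteq> {} \<and> clique \<sigma> E}"

abbreviation partition_complex :: "nat \<Rightarrow> nat list set set" where
  "partition_complex n \<equiv> clique_complex (partitions n) (partition_edges n)"

lemma finite_partition_complex: "finite (partition_complex n)"
  by (rule finite_subset[of _ "Pow (partitions n)"])
     (auto simp: clique_complex_def finite_partitions)

text \<open>For a finite complex; a simplex \<open>\<sigma>\<close> has dimension \<open>card \<sigma> - 1\<close>.\<close>

definition euler_characteristic :: "'a set set \<Rightarrow> int" where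
  "euler_characteristic K = (\<Sum>\<sigma>\<in>K. (-1) ^ (card \<sigma> - 1))"

text \<open>Points are given by barycentric coordinates.  The topology is that of pointwise
  convergence, which is the usual one on the realization of a finite complex (for
  infinite complexes it can be coarser than the weak topology).\<close>

definition geometric_realization :: "'a set set \<Rightarrow> ('a \<Rightarrow> real) topology" where
  "geometric_realization K =
    subtopology (powertop_real UNIV)
      {x. (\<forall>v. 0 \<le> x v) \<and> {v. x v \<noteq> 0} \<in> K \<and> (\<Sum>v | x v \<noteq> 0. x v) = 1}"


section \<open>Wedge sums\<close>

text \<open>The wedge of the pointed spaces \<open>(X i, p i)\<close>, \<open>i \<in> I\<close>: all base points are glued to the
  single point \<open>None\<close>, and the topology is the finest making all the maps \<open>wedge_map p i\<close>
  continuous.  For \<open>I = {}\<close> this is the one-point space.\<close>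

definition wedge_map :: "('i \<Rightarrow> 'a) \<Rightarrow> 'i \<Rightarrow> 'a \<Rightarrow> ('i \<times> 'a) option" where
  "wedge_map p i x = (if x = p i then None else Some (i, x))"

definition wedge_points :: "('i \<Rightarrow> 'a topology) \<Rightarrow> ('i \<Rightarrow> 'a) \<Rightarrow> 'i set \<Rightarrow> ('i \<times> 'a) option set" where
  "wedge_points X p I = insert None (\<Union>i\<in>I. wedge_map p i ` topspace (X i))"

definition wedge :: "('i \<Rightarrow> 'a topology) \<Rightarrow> ('i \<Rightarrow> 'a) \<Rightarrow> 'i set \<Rightarrow> ('i \<times> 'a) option topology" where
  "wedge X p I =
    topology (\<lambda>U. U \<subseteq> wedge_points X p I \<and>
                  (\<forall>i\<in>I. openin (X i) {x \<in> topspace (X i). wedge_map p i x \<in> U}))"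

lemma openin_wedge:
  "openin (wedge X p I) U \<longleftrightarrow>
     U \<subseteq> wedge_points X p I \<and>
     (\<forall>i\<in>I. openin (X i) {x \<in> topspace (X i). wedge_map p i x \<in> U})"
proof -
  have "istopology (\<lambda>U. U \<subseteq> wedge_points X p I \<and>
          (\<forall>i\<in>I. openin (X i) {x \<in> topspace (X i). wedge_map p i x \<in> U}))"
    unfolding istopology_def
  proof (intro conjI allI impI ballI; (elim conjE)?)
    fix S T i
    assume "\<forall>i\<in>I. openin (X i) {x \<in> topspace (X i). wedge_map p i x \<in> S}"
      and "\<forall>i\<in>I. openin (X i) {x \<in> topspace (X i). wedge_map p i x \<in> T}" and "i \<in> I"
    then have "openin (X i) ({x \<in> topspace (X i). wedge_map p i x \<in> S} \<inter>
                             {x \<in> topspace (X i). wedge_map p i x \<in> T})"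
      by (intro openin_Int) auto
    also have "{x \<in> topspace (X i). wedge_map p i x \<in> S} \<inter>
               {x \<in> topspace (X i). wedge_map p i x \<in> T}
             = {x \<in> topspace (X i). wedge_map p i x \<in> S \<inter> T}"
      by auto
    finally show "openin (X i) {x \<in> topspace (X i). wedge_map p i x \<in> S \<inter> T}" .
  next
    fix \<K> i
    assume "\<forall>K\<in>\<K>. K \<subseteq> wedge_points X p I \<and>
              (\<forall>i\<in>I. openin (X i) {x \<in> topspace (X i). wedge_map p i x \<in> K})" and "i \<in> I"
    then have "openin (X i) (\<Union>K\<in>\<K>. {x \<in> topspace (X i). wedge_map p i x \<in> K})"
      by (intro openin_Union) auto
    also have "(\<Union>K\<in>\<K>. {x \<in> topspace (X i). wedge_map p i x \<in> K})
             = {x \<in> topspace (X i). wedge_map p i x \<in> \<Union>\<K>}"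
      by auto
    finally show "openin (X i) {x \<in> topspace (X i). wedge_map p i x \<in> \<Union>\<K>}" .
  qed auto
  then show ?thesis
    by (simp add: wedge_def topology_inverse')
qed

lemma topspace_wedge: "topspace (wedge X p I) = wedge_points X p I"
proof (rule antisym)
  show "topspace (wedge X p I) \<subseteq> wedge_points X p I"
    using openin_topspace[of "wedge X p I"] unfolding openin_wedge by blast
  have "{x \<in> topspace (X i). wedge_map p i x \<in> wedge_points X p I} = topspace (X i)"
    if "i \<in> I" for i
    using that by (auto simp: wedge_points_def)
  then have "openin (wedge X p I) (wedge_points X p I)"
    by (simp add: openin_wedge)
  then show "wedge_points X p I \<subseteq> topspace (wedge X p I)"
    by (rule openin_subset)
qed

lemma quotient_map_wedge:
  assumes "I \<noteq> {}" and p: "\<And>i. i \<in> I \<Longrightarrow> p i \<in> topspace (X i)"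
  shows "quotient_map (sum_topology X I) (wedge X p I) (\<lambda>(i, x). wedge_map p i x)"
proof -
  obtain i where "i \<in> I" using assms(1) by blast
  then have "None \<in> (\<lambda>(i, x). wedge_map p i x) ` Sigma I (topspace \<circ> X)"
    using p[of i] by (force simp: wedge_map_def)
  then have "(\<lambda>(i, x). wedge_map p i x) ` Sigma I (topspace \<circ> X) = wedge_points X p I"
    unfolding wedge_points_def by force
  then show ?thesis
    unfolding quotient_map_def
    by (auto simp: topspace_wedge openin_wedge openin_sum_topology cong: conj_cong)
qed

definition wedge_of_2_spheres :: "nat \<Rightarrow> (nat \<times> (nat \<Rightarrow> real)) option topology" where
  "wedge_of_2_spheres b = wedge (\<lambda>_. nsphere 2) (\<lambda>_ k. if k = 0 then 1 else 0) {..<b}"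

end

(* Cells (r, s) of a Ferrers diagram are encoded as natural numbers by the Cantor pairing, a linear
   extension of the product order, so partitions of n become the order ideals with n elements, and
   two are adjacent iff they share n - 1 cells.  A clique of size at least 3 consists either of
   one-cell extensions of a common ideal (a star) or of subsets of a common (n + 1)-element ideal.

   The star of an ideal mu has a least member, mu with the least missing cell added.  Collapsing away
   the triangles of the star that avoid this member leaves a complex in which the remaining star
   triangles are facets.  Call such a triangle critical if the largest cell of its union already
   belongs to mu.  Without the critical triangles the complex collapses to the vertex {..<n}: a
   vertex l of largest cell sum is dominated, after two rounds of edge collapses, by the vertex that
   moves the largest cell of l to the first free position.

   So the complex is a contractible subcomplex with finitely many triangles attached along their
   whole boundary.  Contracting the subcomplex, which extends to a homotopy of the whole complex, gives
   a wedge of 2-spheres with one sphere for each critical triangle, and the collapses preserve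
   the Euler characteristic. *)

theory Submission
  imports Defs "HOL-Library.Nat_Bijection"
begin

section \<open>Collapses of simplicial complexes\<close>

text \<open>The criterion for critical triangles comes from the order of removal, by decreasing cell
  sum. If the largest cell \<open>M\<close> of the union is not in the intersection
  \<open>\<mu>\<close>, one member \<open>l\<close> is \<open>\<mu>\<close> plus \<open>M\<close>.
  Then \<open>\<mu>\<close> is \<open>l\<close> without its largest cell and
  \<open>fill \<mu>\<close> is the very apex towards which \<open>l\<close> is removed, so the
  triangle disappears together with \<open>l\<close>. If \<open>M\<close> lies in
  \<open>\<mu>\<close>, the triangle obstructs the removal. An edge from \<open>l\<close> to a
  neighbour \<open>B\<close> that keeps \<open>Max l\<close> is pushed to an apex below
  \<open>l \<union> B\<close>, which requires every simplex through the edge to lie below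
  \<open>l \<union> B\<close>. By the dichotomy for cliques, only star triangles over
  \<open>l \<inter> B\<close> can violate this. Their intersection contains \<open>Max l\<close>,
  which is the largest cell of their union, so they are redundant or critical and already absent.
  What is left through \<open>l\<close> then lies in the star of \<open>l - {Max l}\<close>. Stars
  may contain simplices of high dimension. Thinning them first is what reduces the obstruction to
  triangles and makes the spheres 2-dimensional.\<close>

definition abstract_complex :: "'a set set \<Rightarrow> bool" where
  "abstract_complex K \<longleftrightarrow>
     (\<forall>\<sigma>\<in>K. finite \<sigma> \<and> \<sigma> \<noteq> {}) \<and> (\<forall>\<sigma>\<in>K. \<forall>\<tau>. \<tau> \<subseteq> \<sigma> \<and> \<tau> \<noteq> {} \<longrightarrow> \<tau> \<in> K)"

definition realization_points :: "'a set set \<Rightarrow> ('a \<Rightarrow> real) set" where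
  "realization_points K = {x. (\<forall>v. 0 \<le> x v) \<and> {v. x v \<noteq> 0} \<in> K \<and> (\<Sum>v | x v \<noteq> 0. x v) = 1}"

lemma geometric_realization_eq:
  "geometric_realization K = subtopology (powertop_real UNIV) (realization_points K)"
  by (simp add: geometric_realization_def realization_points_def)

lemma topspace_geometric_realization [simp]:
  "topspace (geometric_realization K) = realization_points K"
  by (simp add: geometric_realization_eq)

lemma abstract_complex_finite: "abstract_complex K \<Longrightarrow> \<sigma> \<in> K \<Longrightarrow> finite \<sigma>"
  by (simp add: abstract_complex_def)

lemma abstract_complex_face:
  "abstract_complex K \<Longrightarrow> \<sigma> \<in> K \<Longrightarrow> \<tau> \<subseteq> \<sigma> \<Longrightarrow> \<tau> \<noteq> {} \<Longrightarrow> \<tau> \<in> K"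
  unfolding abstract_complex_def by blast

lemma realization_pointsI:
  assumes K: "abstract_complex K" "\<sigma> \<in> K" and "\<And>v. 0 \<le> x v" "\<And>v. v \<notin> \<sigma> \<Longrightarrow> x v = 0" "sum x \<sigma> = 1"
  shows "x \<in> realization_points K"
proof -
  have sub: "{v. x v \<noteq> 0} \<subseteq> \<sigma>" using assms(4) by auto
  have "sum x {v. x v \<noteq> 0} = sum x \<sigma>"
    by (rule sum.mono_neutral_left) (use sub abstract_complex_finite[OF K] in auto)
  then have 1: "sum x {v. x v \<noteq> 0} = 1" using assms by simp
  then have "{v. x v \<noteq> 0} \<noteq> {}" by (metis sum.empty zero_neq_one)
  then show ?thesis
    using abstract_complex_face[OF K sub] 1 assms(3) by (simp add: realization_points_def)
qed

lemma realization_points_sum: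
  assumes "x \<in> realization_points K" "finite \<sigma>" "{v. x v \<noteq> 0} \<subseteq> \<sigma>"
  shows "sum x \<sigma> = 1"
proof -
  have "sum x {v. x v \<noteq> 0} = sum x \<sigma>"
    by (rule sum.mono_neutral_left) (use assms in auto)
  then show ?thesis using assms(1) by (simp add: realization_points_def)
qed

lemma continuous_map_coordinate [continuous_intros]:
  "continuous_map (geometric_realization K) euclideanreal (\<lambda>x. x v)"
  unfolding geometric_realization_eq
  by (intro continuous_map_from_subtopology) (rule continuous_map_product_projection[OF UNIV_I])

lemma continuous_map_into_realization:
  "continuous_map X (geometric_realization K) f \<longleftrightarrow>
     (\<forall>v. continuous_map X euclideanreal (\<lambda>x. f x v)) \<and> f \<in> topspace X \<rightarrow> realization_points K"
  by (auto simp: geometric_realization_eq continuous_map_in_subtopology continuous_map_componentwise_UNIV)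

lemma continuous_map_coordinate_comp [continuous_intros]:
  assumes "continuous_map X (geometric_realization K) f"
  shows "continuous_map X euclideanreal (\<lambda>x. f x v)"
  using assms by (simp add: continuous_map_into_realization)

lemma continuous_map_if_const:
  assumes "continuous_map X Y f" "continuous_map X Y g"
  shows "continuous_map X Y (\<lambda>x. if P then f x else g x)"
  using assms by simp

lemma continuous_map_Min [continuous_intros]:
  assumes "finite A" "A \<noteq> {}" "\<And>a. a \<in> A \<Longrightarrow> continuous_map X euclideanreal (\<lambda>x. f x a)"
  shows "continuous_map X euclideanreal (\<lambda>x. Min (f x ` A))"
  using assms
proof (induction A rule: finite_ne_induct)
  case (singleton a)
  then show ?case by simp
next
  case (insert a A)
  have "(\<lambda>x. Min (f x ` insert a A)) = (\<lambda>x. min (f x a) (Min (f x ` A)))"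
    using insert.hyps by (simp add: fun_eq_iff)
  moreover have "continuous_map X euclideanreal (\<lambda>x. min (f x a) (Min (f x ` A)))"
    using insert by (intro continuous_map_real_min) auto
  ultimately show ?case by simp
qed

text \<open>Points moved by the collapse have all of \<open>\<tau>\<close> in their support; sliding as much mass as
  possible from \<open>\<tau>\<close> to the apex \<open>w\<close> stays inside the simplex spanned by the support and \<open>w\<close>.\<close>

definition slide :: "'a set \<Rightarrow> 'a \<Rightarrow> real \<Rightarrow> ('a \<Rightarrow> real) \<Rightarrow> 'a \<Rightarrow> real" where
  "slide \<tau> w t x = (\<lambda>v. x v - (if v \<in> \<tau> then t * Min (x ` \<tau>) else 0)
                        + (if v = w then t * real (card \<tau>) * Min (x ` \<tau>) else 0))"

lemma abstract_complex_remove_star: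
  assumes "abstract_complex K"
  shows "abstract_complex {\<sigma> \<in> K. \<not> \<tau> \<subseteq> \<sigma>}"
  unfolding abstract_complex_def
proof (intro conjI ballI allI impI)
  fix \<sigma> \<rho> assume "\<sigma> \<in> {\<sigma> \<in> K. \<not> \<tau> \<subseteq> \<sigma>}" and \<rho>: "\<rho> \<subseteq> \<sigma> \<and> \<rho> \<noteq> {}"
  then show "\<rho> \<in> {\<sigma> \<in> K. \<not> \<tau> \<subseteq> \<sigma>}"
    using abstract_complex_face[OF assms, of \<sigma> \<rho>] by auto
qed (use assms in \<open>auto simp: abstract_complex_def\<close>)

lemma slide_in_realization:
  assumes K: "abstract_complex K" and \<tau>: "finite \<tau>" "\<tau> \<noteq> {}" "w \<notin> \<tau>"
    and cone: "\<And>\<sigma>. \<sigma> \<in> K \<Longrightarrow> \<tau> \<subseteq> \<sigma> \<Longrightarrow> insert w \<sigma> \<in> K"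
    and x: "x \<in> realization_points K" and t: "0 \<le> t" "t \<le> 1"
  shows "slide \<tau> w t x \<in> realization_points K"
proof -
  let ?m = "Min (x ` \<tau>)"
  let ?s = "{v. x v \<noteq> 0}"
  have x0: "x v \<ge> 0" for v using x by (simp add: realization_points_def)
  have m0: "?m \<ge> 0" using \<tau> x0 by simp
  have mle: "?m \<le> x v" if "v \<in> \<tau>" for v using \<tau> that by simp
  have s: "?s \<in> K" using x by (simp add: realization_points_def)
  show ?thesis
  proof (cases "?m = 0")
    case True
    then have "slide \<tau> w t x = x" by (simp add: slide_def fun_eq_iff)
    then show ?thesis using x by simp
  next
    case False
    then have sub: "\<tau> \<subseteq> ?s" using m0 mle by force
    then have ins: "insert w ?s \<in> K" using cone s by blast
    have fin: "finite (insert w ?s)" using abstract_complex_finite[OF K ins] .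
    have "sum (slide \<tau> w t x) (insert w ?s)
        = sum x (insert w ?s) - (\<Sum>v\<in>insert w ?s. if v \<in> \<tau> then t * ?m else 0)
          + (\<Sum>v\<in>insert w ?s. if v = w then t * real (card \<tau>) * ?m else 0)"
      unfolding slide_def by (simp only: sum.distrib sum_subtractf)
    also have "sum x (insert w ?s) = 1"
      using realization_points_sum[OF x fin] by blast
    also have "(\<Sum>v\<in>insert w ?s. if v \<in> \<tau> then t * ?m else 0) = (\<Sum>v\<in>\<tau>. t * ?m)"
      by (rule sum.mono_neutral_cong_right) (use fin sub in auto)
    also have "(\<Sum>v\<in>insert w ?s. if v = w then t * real (card \<tau>) * ?m else 0) = t * real (card \<tau>) * ?m"
      using fin by simp
    finally have sum1: "sum (slide \<tau> w t x) (insert w ?s) = 1" by simp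
    show ?thesis
    proof (rule realization_pointsI[OF K ins])
      fix v
      have "t * ?m \<le> x v" if "v \<in> \<tau>"
        using mult_right_mono[OF t(2) m0] mle[OF that] by linarith
      moreover have "0 \<le> t * real (card \<tau>) * ?m" using t m0 by simp
      ultimately show "0 \<le> slide \<tau> w t x v"
        using x0[of v] by (auto simp: slide_def)
      show "slide \<tau> w t x v = 0" if "v \<notin> insert w ?s"
        using that sub by (auto simp: slide_def)
    qed (rule sum1)
  qed
qed

text \<open>The hypothesis \<open>cone\<close> says that the link of \<open>\<tau>\<close> is a cone
  with apex \<open>w\<close>. The full slide \<open>t = 1\<close> empties some vertex of
  \<open>\<tau>\<close>, and points that already miss a vertex of \<open>\<tau>\<close> never move,
  so sliding is a deformation retraction that removes the open star of
  \<open>\<tau>\<close>.\<close>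

lemma collapse_homotopy_equivalent:
  assumes K: "abstract_complex K" and \<tau>: "finite \<tau>" "\<tau> \<noteq> {}" "w \<notin> \<tau>"
    and cone: "\<And>\<sigma>. \<sigma> \<in> K \<Longrightarrow> \<tau> \<subseteq> \<sigma> \<Longrightarrow> insert w \<sigma> \<in> K"
  shows "geometric_realization K homotopy_equivalent_space
         geometric_realization {\<sigma> \<in> K. \<not> \<tau> \<subseteq> \<sigma>}"
proof -
  let ?L = "{\<sigma> \<in> K. \<not> \<tau> \<subseteq> \<sigma>}"
  have L: "abstract_complex ?L" using abstract_complex_remove_star[OF K] .
  note slideK = slide_in_realization[OF K \<tau> cone]
  have cont: "continuous_map X euclideanreal (\<lambda>z. slide \<tau> w (f z) (g z) v)"
    if "continuous_map X euclideanreal f" "continuous_map X (geometric_realization K) g" for X f v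
    and g :: "'c \<Rightarrow> 'a \<Rightarrow> real"
  proof -
    have g: "continuous_map X euclideanreal (\<lambda>z. g z v)" for v
      using continuous_map_coordinate_comp[OF that(2)] .
    have m: "continuous_map X euclideanreal (\<lambda>z. Min (g z ` \<tau>))"
      by (rule continuous_map_Min[OF \<tau>(1,2) g])
    show ?thesis
      unfolding slide_def
      by (rule continuous_map_add continuous_map_diff continuous_map_if_const
            continuous_map_real_mult g m that(1) continuous_map_const[THEN iffD2] disjI2 | simp)+
  qed
  have slideL: "slide \<tau> w 1 x \<in> realization_points ?L" if x: "x \<in> realization_points K" for x
  proof -
    have "slide \<tau> w 1 x \<in> realization_points K" using slideK[OF _ _ x] by simp
    \<comment> \<open>The coordinate at which the minimum is attained drops to 0; it is not refilled
      because \<open>w \<notin> \<tau>\<close>.\<close>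
    moreover have "\<exists>v\<in>\<tau>. slide \<tau> w 1 x v = 0"
    proof -
      have "Min (x ` \<tau>) \<in> x ` \<tau>" using \<tau> by simp
      then obtain v where "v \<in> \<tau>" "x v = Min (x ` \<tau>)" by (metis imageE)
      then show ?thesis using \<tau>(3) by (intro bexI[of _ v]) (auto simp: slide_def)
    qed
    ultimately show ?thesis by (auto simp: realization_points_def)
  qed
  have sub: "realization_points ?L \<subseteq> realization_points K"
    by (auto simp: realization_points_def)
  have fix_L: "slide \<tau> w t x = x" if x: "x \<in> realization_points ?L" for x t
  proof -
    have "\<not> \<tau> \<subseteq> {v. x v \<noteq> 0}" "\<And>v. 0 \<le> x v" using x by (auto simp: realization_points_def)
    then obtain v where "v \<in> \<tau>" "x v = 0" by blast
    then have "Min (x ` \<tau>) = 0"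
      using \<tau> \<open>\<And>v. 0 \<le> x v\<close> by (intro Min_eqI) (auto simp: image_iff intro: bexI[of _ v])
    then show ?thesis by (simp add: slide_def fun_eq_iff)
  qed
  show ?thesis
    unfolding homotopy_equivalent_space_def
  proof (intro exI conjI)
    show r: "continuous_map (geometric_realization K) (geometric_realization ?L) (slide \<tau> w 1)"
      unfolding continuous_map_into_realization
      using cont[of "geometric_realization K" "\<lambda>_. 1" id] slideL by simp
    show i: "continuous_map (geometric_realization ?L) (geometric_realization K) id"
      unfolding continuous_map_into_realization using sub by (auto intro: continuous_intros)
    show "homotopic_with (\<lambda>x. True) (geometric_realization K) (geometric_realization K)
            (id \<circ> slide \<tau> w 1) id"
    proof -
      let ?X = "prod_topology (top_of_set {0..1::real}) (geometric_realization K)"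
      define h where "h = (\<lambda>z. slide \<tau> w (1 - fst z) (snd z))"
      have "continuous_map ?X (geometric_realization K) h"
        unfolding continuous_map_into_realization
      proof (intro conjI allI)
        have "continuous_map ?X euclideanreal fst"
          using continuous_map_fst continuous_map_in_subtopology by blast
        then have "continuous_map ?X euclideanreal (\<lambda>z. 1 - fst z)"
          by (intro continuous_map_diff) auto
        then show "continuous_map ?X euclideanreal (\<lambda>x. h x v)" for v
          unfolding h_def by (rule cont) (rule continuous_map_snd)
      qed (use slideK in \<open>auto simp: h_def\<close>)
      moreover have "h (0, x) = slide \<tau> w 1 x" "h (1, x) = x" for x
        by (auto simp: h_def slide_def fun_eq_iff)
      ultimately show ?thesis
        unfolding homotopic_with_def by (intro exI[of _ h]) simp
    qed
    show "homotopic_with (\<lambda>x. True) (geometric_realization ?L) (geometric_realization ?L)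
            (slide \<tau> w 1 \<circ> id) id"
      by (rule homotopic_with_equal) (use fix_L continuous_map_compose[OF i r] in auto)
  qed
qed

text \<open>Adding and deleting \<open>w\<close> pairs off the simplices that contain
  \<open>\<tau>\<close>. The dimensions in a pair differ by one, so the removed star contributes 0
  to the alternating sum.\<close>

lemma euler_characteristic_collapse:
  assumes K: "abstract_complex K" "finite K" and "w \<notin> \<tau>" "\<tau> \<noteq> {}"
    and cone: "\<And>\<sigma>. \<sigma> \<in> K \<Longrightarrow> \<tau> \<subseteq> \<sigma> \<Longrightarrow> insert w \<sigma> \<in> K"
  shows "euler_characteristic K = euler_characteristic {\<sigma> \<in> K. \<not> \<tau> \<subseteq> \<sigma>}"
proof -
  let ?s = "\<lambda>\<sigma>. (-1::int) ^ (card \<sigma> - 1)"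
  let ?A = "{\<sigma> \<in> K. \<tau> \<subseteq> \<sigma> \<and> w \<notin> \<sigma>}"
  let ?B = "{\<sigma> \<in> K. \<tau> \<subseteq> \<sigma> \<and> w \<in> \<sigma>}"
  have "sum ?s ?B = sum ?s (insert w ` ?A)"
  proof (rule arg_cong[where f = "sum ?s"], rule antisym; rule subsetI)
    fix \<sigma> assume "\<sigma> \<in> ?B"
    then have "\<sigma> \<in> K" "\<tau> \<subseteq> \<sigma> - {w}" and \<sigma>: "\<sigma> = insert w (\<sigma> - {w})"
      using \<open>w \<notin> \<tau>\<close> by auto
    then have "\<sigma> - {w} \<in> ?A"
      using abstract_complex_face[OF K(1), of \<sigma> "\<sigma> - {w}"] \<open>\<tau> \<noteq> {}\<close> by blast
    with \<sigma> have "\<sigma> - {w} \<in> ?A" "\<sigma> = insert w (\<sigma> - {w})" by blast+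
    then show "\<sigma> \<in> insert w ` ?A" by blast
  qed (use cone in auto)
  also have "\<dots> = (\<Sum>\<sigma>\<in>?A. ?s (insert w \<sigma>))"
    by (rule sum.reindex_cong[OF _ refl]) (auto simp: inj_on_def)
  also have "\<dots> = (\<Sum>\<sigma>\<in>?A. - ?s \<sigma>)"
  proof (rule sum.cong[OF refl])
    fix \<sigma> assume "\<sigma> \<in> ?A"
    then have "finite \<sigma>" "\<sigma> \<noteq> {}" "w \<notin> \<sigma>" using K by (auto simp: abstract_complex_def)
    then show "?s (insert w \<sigma>) = - ?s \<sigma>"
      by (cases "card \<sigma>") auto
  qed
  finally have AB: "sum ?s ?A + sum ?s ?B = 0" by (simp add: sum_negf)
  have "sum ?s K = sum ?s ({\<sigma> \<in> K. \<not> \<tau> \<subseteq> \<sigma>} \<union> (?A \<union> ?B))"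
    by (rule arg_cong[where f = "sum ?s"]) auto
  also have "\<dots> = sum ?s {\<sigma> \<in> K. \<not> \<tau> \<subseteq> \<sigma>} + (sum ?s ?A + sum ?s ?B)"
    using K(2) by (subst sum.union_disjoint, auto)+
  finally show ?thesis using AB by (simp add: euler_characteristic_def)
qed

text \<open>Only the invariants of a collapse are recorded; the relation is vacuous unless \<open>K\<close> is a
  finite complex.\<close>

definition collapses :: "'a set set \<Rightarrow> 'a set set \<Rightarrow> bool" where
  "collapses K L \<longleftrightarrow> (abstract_complex K \<and> finite K \<longrightarrow>
     abstract_complex L \<and> finite L \<and> euler_characteristic K = euler_characteristic L \<and>
     geometric_realization K homotopy_equivalent_space geometric_realization L)"

lemma collapses_refl: "collapses K K"
  by (simp add: collapses_def homotopy_equivalent_space_refl)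

lemma collapses_trans: "collapses K L \<Longrightarrow> collapses L M \<Longrightarrow> collapses K M"
  unfolding collapses_def by (auto intro: homotopy_eqv_trans)

lemma collapses_star:
  assumes "finite \<tau>" "\<tau> \<noteq> {}" "w \<notin> \<tau>" "\<And>\<sigma>. \<sigma> \<in> K \<Longrightarrow> \<tau> \<subseteq> \<sigma> \<Longrightarrow> insert w \<sigma> \<in> K"
  shows "collapses K {\<sigma> \<in> K. \<not> \<tau> \<subseteq> \<sigma>}"
  unfolding collapses_def
proof (intro impI conjI; elim conjE)
  assume K: "abstract_complex K" "finite K"
  show "abstract_complex {\<sigma> \<in> K. \<not> \<tau> \<subseteq> \<sigma>}"
    by (rule abstract_complex_remove_star[OF K(1)])
  show "finite {\<sigma> \<in> K. \<not> \<tau> \<subseteq> \<sigma>}"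
    using K(2) by simp
  show "euler_characteristic K = euler_characteristic {\<sigma> \<in> K. \<not> \<tau> \<subseteq> \<sigma>}"
    by (rule euler_characteristic_collapse[OF K assms(3,2,4)])
  show "geometric_realization K homotopy_equivalent_space
        geometric_realization {\<sigma> \<in> K. \<not> \<tau> \<subseteq> \<sigma>}"
    by (rule collapse_homotopy_equivalent[OF K(1) assms])
qed

text \<open>The stars are removed one at a time, in any order. The hypothesis \<open>new\<close>
  excludes interference: adding the apex of \<open>\<tau>\<close> to a simplex never completes
  another member of \<open>S\<close>, so the cone condition survives the earlier removals.\<close>

lemma collapses_stars:
  assumes "finite S" and S: "\<And>\<tau>. \<tau> \<in> S \<Longrightarrow> finite \<tau> \<and> \<tau> \<noteq> {} \<and> w \<tau> \<notin> \<tau>"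
    and cone: "\<And>\<tau> \<sigma>. \<tau> \<in> S \<Longrightarrow> \<sigma> \<in> K \<Longrightarrow> \<tau> \<subseteq> \<sigma> \<Longrightarrow> insert (w \<tau>) \<sigma> \<in> K"
    and new: "\<And>\<tau> \<tau>' \<sigma>. \<tau> \<in> S \<Longrightarrow> \<tau>' \<in> S \<Longrightarrow> \<sigma> \<in> K \<Longrightarrow> \<tau> \<subseteq> \<sigma> \<Longrightarrow> \<tau>' \<subseteq> insert (w \<tau>) \<sigma> \<Longrightarrow> \<tau>' \<subseteq> \<sigma>"
  shows "collapses K {\<sigma> \<in> K. \<forall>\<tau>\<in>S. \<not> \<tau> \<subseteq> \<sigma>}"
  using assms
proof (induction S)
  case empty
  show ?case by (simp add: collapses_refl)
next
  case (insert \<tau> S)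
  let ?L = "{\<sigma> \<in> K. \<forall>\<tau>\<in>S. \<not> \<tau> \<subseteq> \<sigma>}"
  have "collapses K ?L"
  proof (rule insert.IH)
    show "\<tau>'' \<subseteq> \<sigma>" if "\<tau>' \<in> S" "\<tau>'' \<in> S" "\<sigma> \<in> K" "\<tau>' \<subseteq> \<sigma>" "\<tau>'' \<subseteq> insert (w \<tau>') \<sigma>" for \<tau>' \<tau>'' \<sigma>
      using that insert.prems(3)[of \<tau>' \<tau>'' \<sigma>] by blast
    show "finite \<tau>' \<and> \<tau>' \<noteq> {} \<and> w \<tau>' \<notin> \<tau>'" if "\<tau>' \<in> S" for \<tau>'
      using that by (intro insert.prems(1) insertI2)
    show "insert (w \<tau>') \<sigma> \<in> K" if "\<tau>' \<in> S" "\<sigma> \<in> K" "\<tau>' \<subseteq> \<sigma>" for \<tau>' \<sigma>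
      using that by (intro insert.prems(2)[of \<tau>' \<sigma>] insertI2)
  qed
  moreover have "collapses ?L {\<sigma> \<in> ?L. \<not> \<tau> \<subseteq> \<sigma>}"
  proof (rule collapses_star[where w = "w \<tau>"])
    fix \<sigma> assume \<sigma>: "\<sigma> \<in> ?L" "\<tau> \<subseteq> \<sigma>"
    then have "insert (w \<tau>) \<sigma> \<in> K"
      by (intro insert.prems(2)[of \<tau> \<sigma>]) auto
    moreover have "\<not> \<tau>' \<subseteq> insert (w \<tau>) \<sigma>" if "\<tau>' \<in> S" for \<tau>'
      using that \<sigma> insert.prems(3)[of \<tau> \<tau>' \<sigma>] by auto
    ultimately show "insert (w \<tau>) \<sigma> \<in> ?L" by simp
  qed (use insert.prems(1)[of \<tau>] in simp_all)
  moreover have "{\<sigma> \<in> ?L. \<not> \<tau> \<subseteq> \<sigma>} = {\<sigma> \<in> K. \<forall>\<tau>\<in>insert \<tau> S. \<not> \<tau> \<subseteq> \<sigma>}" by auto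
  ultimately show ?case using collapses_trans[of K ?L] by simp
qed

section \<open>Contracting a subcomplex\<close>

lemma homotopic_with_TrueI:
  assumes "continuous_map (prod_topology (top_of_set {0..1::real}) X) Y h"
    and "\<And>x. x \<in> topspace X \<Longrightarrow> h (0, x) = f x" "\<And>x. x \<in> topspace X \<Longrightarrow> h (1, x) = g x"
  shows "homotopic_with (\<lambda>x. True) X Y f g"
proof (subst homotopic_with)
  show "\<exists>h. continuous_map (prod_topology (top_of_set {0..1::real}) X) Y h \<and>
          (\<forall>x\<in>topspace X. h (0, x) = f x) \<and> (\<forall>x\<in>topspace X. h (1, x) = g x) \<and>
          (\<forall>t\<in>{0..1::real}. True)"
    using assms by (intro exI[of _ h]) simp
qed simp

text \<open>The classical fact that crushing a contractible subspace \<open>A\<close> with the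
  homotopy extension property does not change the homotopy type. Here \<open>h\<close> is the
  extended contraction. Its end map is constant on \<open>A\<close> and descends to a homotopy
  inverse \<open>s\<close> of \<open>q\<close>; the whole homotopy descends to \<open>k\<close>,
  which connects the identity of \<open>Y\<close> with \<open>q \<circ> s\<close>.\<close>

lemma quotient_homotopy_equivalent:
  assumes q: "quotient_map X Y q"
    and h: "continuous_map (prod_topology (top_of_set {0..1::real}) X) X h"
    and h0: "\<And>x. x \<in> topspace X \<Longrightarrow> h (0, x) = x"
    and A: "A \<subseteq> topspace X" "\<And>t x. t \<in> {0..1} \<Longrightarrow> x \<in> A \<Longrightarrow> h (t, x) \<in> A"
      "\<And>x. x \<in> A \<Longrightarrow> h (1, x) = a"
    and q_A: "\<And>x y. x \<in> A \<Longrightarrow> y \<in> A \<Longrightarrow> q x = q y"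
    and q_inj: "\<And>x y. x \<in> topspace X \<Longrightarrow> y \<in> topspace X \<Longrightarrow> q x = q y \<Longrightarrow> x = y \<or> x \<in> A \<and> y \<in> A"
  shows "X homotopy_equivalent_space Y"
proof -
  let ?I = "top_of_set {0..1::real}"
  have cq: "continuous_map X Y q" and q_in: "\<And>x. x \<in> topspace X \<Longrightarrow> q x \<in> topspace Y"
    using quotient_imp_continuous_map[OF q] by (auto simp: continuous_map_def)
  have cslice: "continuous_map X X (\<lambda>x. h (1, x))"
    using continuous_map_compose[of X "prod_topology ?I X" "\<lambda>x. (1, x)", OF _ h]
    by (simp add: continuous_map_pairedI comp_def)
  obtain s where s: "continuous_map Y X s" "\<And>x. x \<in> topspace X \<Longrightarrow> s (q x) = h (1, x)"
  proof (rule quotient_map_lift_exists[OF q cslice])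
    fix x y assume "x \<in> topspace X" "y \<in> topspace X" "q x = q y"
    then show "h (1, x) = h (1, y)" using q_inj[of x y] A(3) by auto
  qed auto
  \<comment> \<open>Descending a homotopy needs the product of \<open>q\<close> with the interval to
    be a quotient map; this is where local compactness of the interval enters.\<close>
  have qI: "quotient_map (prod_topology ?I X) (prod_topology ?I Y) (\<lambda>(t, x). (t, q x))"
  proof (rule quotient_map_prod_right[OF _ _ q])
    show "locally_compact_space ?I"
      by (simp add: compact_imp_locally_compact_space compact_space_subtopology)
    show "Hausdorff_space ?I \<or> regular_space ?I"
      by (simp add: Hausdorff_space_subtopology)
  qed
  have cqh: "continuous_map (prod_topology ?I X) Y (q \<circ> h)"
    by (rule continuous_map_compose[OF h cq])
  obtain k where k: "continuous_map (prod_topology ?I Y) Y k"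
    "\<And>z. z \<in> topspace (prod_topology ?I X) \<Longrightarrow> k ((\<lambda>(t, x). (t, q x)) z) = (q \<circ> h) z"
  proof (rule quotient_map_lift_exists[OF qI cqh])
    fix z z' assume z: "z \<in> topspace (prod_topology ?I X)" "z' \<in> topspace (prod_topology ?I X)"
      and eq: "(\<lambda>(t, x). (t, q x)) z = (\<lambda>(t, x). (t, q x)) z'"
    obtain t x t' x' where zz: "z = (t, x)" "z' = (t', x')" by (cases z, cases z')
    then have "t' = t" "q x = q x'" using eq by auto
    then show "(q \<circ> h) z = (q \<circ> h) z'"
      using q_inj[of x x'] z zz q_A A(2)[of t x] A(2)[of t x'] by auto
  qed auto
  have k': "k (t, q x) = q (h (t, x))" if "t \<in> {0..1}" "x \<in> topspace X" for t x
    using k(2)[of "(t, x)"] that by simp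
  show ?thesis
    unfolding homotopy_equivalent_space_def
  proof (intro exI conjI)
    show "continuous_map X Y q" by (rule cq)
    show "continuous_map Y X s" by (rule s(1))
    have "homotopic_with (\<lambda>x. True) X X id (s \<circ> q)"
      by (rule homotopic_with_TrueI[OF h]) (simp_all add: h0 s(2))
    then show "homotopic_with (\<lambda>x. True) X X (s \<circ> q) id"
      by (rule homotopic_with_symD)
    have surj: "q ` topspace X = topspace Y" using quotient_imp_surjective_map[OF q] .
    have "k (0, y) = y \<and> k (1, y) = q (s y)" if "y \<in> topspace Y" for y
    proof -
      have "y \<in> q ` topspace X" using that by (simp only: surj)
      then obtain x where "x \<in> topspace X" "y = q x" by (elim imageE)
      then show ?thesis using k'[of 0 x] k'[of 1 x] h0 s(2) by simp
    qed
    then have "homotopic_with (\<lambda>x. True) Y Y id (q \<circ> s)"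
      by (intro homotopic_with_TrueI[OF k(1)]) simp_all
    then show "homotopic_with (\<lambda>x. True) Y Y (q \<circ> s) id"
      by (rule homotopic_with_symD)
  qed
qed

section \<open>Triangular facets and the homotopy extension property\<close>

lemma abstract_complex_remove_facets:
  assumes "abstract_complex K" and "\<And>\<sigma> \<tau>. \<tau> \<in> F \<Longrightarrow> \<sigma> \<in> K \<Longrightarrow> \<tau> \<subseteq> \<sigma> \<Longrightarrow> \<sigma> = \<tau>"
  shows "abstract_complex (K - F)"
  unfolding abstract_complex_def
proof (intro conjI ballI allI impI)
  fix \<sigma> \<rho> assume "\<sigma> \<in> K - F" and \<rho>: "\<rho> \<subseteq> \<sigma> \<and> \<rho> \<noteq> {}"
  then show "\<rho> \<in> K - F"
    using abstract_complex_face[OF assms(1), of \<sigma> \<rho>] assms(2)[of \<rho> \<sigma>] by auto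
qed (use assms(1) in \<open>auto simp: abstract_complex_def\<close>)

text \<open>Inside a facet \<open>\<tau>\<close> this is a push away from the barycentre: with
  \<open>e = min (Min x) (t / 6)\<close>, where \<open>Min x\<close> is the least coordinate on
  \<open>\<tau>\<close>, the mass \<open>e\<close> is taken from each of the three vertices and the
  rest is rescaled by \<open>1 - 3 * e\<close>. For \<open>t \<le> 1\<close> the bound
  \<open>t / 6\<close> keeps the denominator at least \<open>1 / 2\<close>, even at the barycentre.
  At most one summand is nonzero at a point of the realization; summing over all facets gives one
  formula that is visibly continuous.\<close>

definition press :: "'a set set \<Rightarrow> real \<Rightarrow> ('a \<Rightarrow> real) \<Rightarrow> 'a \<Rightarrow> real" where
  "press F t x = (\<lambda>v. (x v - (\<Sum>\<tau>\<in>F. if v \<in> \<tau> then min (Min (x ` \<tau>)) (t / 6) else 0)) /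
                      (1 - (\<Sum>\<tau>\<in>F. 3 * min (Min (x ` \<tau>)) (t / 6))))"

text \<open>Scaled to be 0 on the boundary and 1 at the barycentre of a facet. Inside a facet,
  \<open>2 * depth F x \<le> t\<close> means that the least coordinate is at most
  \<open>t / 6\<close>, which is when \<open>press F t\<close> reaches the boundary.\<close>

definition depth :: "'a set set \<Rightarrow> ('a \<Rightarrow> real) \<Rightarrow> real" where
  "depth F x = (\<Sum>\<tau>\<in>F. 3 * Min (x ` \<tau>))"

locale triangle_facets =
  fixes K F :: "'a set set"
  assumes complex: "abstract_complex K"
    and finite_facets: "finite F" and facets_subset: "F \<subseteq> K"
    and card_facet: "\<And>\<tau>. \<tau> \<in> F \<Longrightarrow> card \<tau> = 3"
    and facet_maximal: "\<And>\<tau> \<sigma>. \<tau> \<in> F \<Longrightarrow> \<sigma> \<in> K \<Longrightarrow> \<tau> \<subseteq> \<sigma> \<Longrightarrow> \<sigma> = \<tau>"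
begin

lemma complex_rest: "abstract_complex (K - F)"
  by (rule abstract_complex_remove_facets[OF complex facet_maximal])

lemma facet_finite: "\<tau> \<in> F \<Longrightarrow> finite \<tau> \<and> \<tau> \<noteq> {}"
  using card_facet by (force intro: card_ge_0_finite)

lemma rest_subset: "realization_points (K - F) \<subseteq> realization_points K"
  by (auto simp: realization_points_def)

lemma Min_facet_nonneg:
  assumes "x \<in> realization_points K" "\<tau> \<in> F" shows "0 \<le> Min (x ` \<tau>)"
  using assms facet_finite[of \<tau>] by (auto simp: realization_points_def)

text \<open>By maximality of \<open>\<tau>\<close>, a support that contains \<open>\<tau>\<close>
  equals it; any other support misses a vertex of \<open>\<tau>\<close>. Hence at most one summand
  of the sums over \<open>F\<close> is nonzero at a given point.\<close>

lemma Min_facet_eq_0: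
  assumes x: "x \<in> realization_points K" and \<tau>: "\<tau> \<in> F" and ne: "{v. x v \<noteq> 0} \<noteq> \<tau>"
  shows "Min (x ` \<tau>) = 0"
proof -
  have "\<not> \<tau> \<subseteq> {v. x v \<noteq> 0}"
    using facet_maximal[OF \<tau>, of "{v. x v \<noteq> 0}"] ne x by (auto simp: realization_points_def)
  then obtain v where "v \<in> \<tau>" "x v = 0" by blast
  then have "Min (x ` \<tau>) \<le> 0" using facet_finite[OF \<tau>] by (metis Min_le finite_imageI imageI)
  then show ?thesis using Min_facet_nonneg[OF x \<tau>] by simp
qed

lemma Min_rest_eq_0:
  assumes "x \<in> realization_points (K - F)" and "\<tau> \<in> F"
  shows "Min (x ` \<tau>) = 0"
  using Min_facet_eq_0[of x \<tau>] assms rest_subset by (auto simp: realization_points_def)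

lemma sum_facets_interior:
  assumes x: "x \<in> realization_points K" "{v. x v \<noteq> 0} = \<tau>" "\<tau> \<in> F"
    and g: "\<And>\<rho>. \<rho> \<in> F \<Longrightarrow> Min (x ` \<rho>) = 0 \<Longrightarrow> g \<rho> = 0"
  shows "sum g F = (g \<tau> :: real)"
proof -
  have "sum g F = sum g {\<tau>}"
    by (rule sum.mono_neutral_right) (use x g Min_facet_eq_0[OF x(1)] finite_facets in auto)
  then show ?thesis by simp
qed

lemma depth_nonneg: "x \<in> realization_points K \<Longrightarrow> 0 \<le> depth F x"
  unfolding depth_def by (intro sum_nonneg mult_nonneg_nonneg) (use Min_facet_nonneg in auto)

lemma depth_rest: "x \<in> realization_points (K - F) \<Longrightarrow> depth F x = 0"
  unfolding depth_def using Min_rest_eq_0 by (intro sum.neutral) auto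

lemma press_rest: "x \<in> realization_points (K - F) \<Longrightarrow> 0 \<le> t \<Longrightarrow> press F t x = x"
proof -
  assume "x \<in> realization_points (K - F)" "0 \<le> t"
  then have "(\<Sum>\<tau>\<in>F. if v \<in> \<tau> then min (Min (x ` \<tau>)) (t / 6) else 0) = 0"
    "(\<Sum>\<tau>\<in>F. 3 * min (Min (x ` \<tau>)) (t / 6)) = 0" for v
    by (auto intro!: sum.neutral simp: Min_rest_eq_0)
  then show ?thesis by (simp add: press_def)
qed

lemma press_0:
  assumes "x \<in> realization_points K" shows "press F 0 x = x"
proof -
  have "min (Min (x ` \<tau>)) 0 = 0" if "\<tau> \<in> F" for \<tau>
    using Min_facet_nonneg[OF assms that] by simp
  then have "(\<Sum>\<tau>\<in>F. if v \<in> \<tau> then min (Min (x ` \<tau>)) (0 / 6) else 0) = 0"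
    "(\<Sum>\<tau>\<in>F. 3 * min (Min (x ` \<tau>)) (0 / 6)) = 0" for v
    by (auto intro!: sum.neutral)
  then show ?thesis unfolding press_def by simp
qed

lemma press_interior:
  assumes x: "x \<in> realization_points K" "{v. x v \<noteq> 0} = \<tau>" "\<tau> \<in> F" and t: "0 \<le> t"
  shows "press F t x = (\<lambda>v. (x v - (if v \<in> \<tau> then min (Min (x ` \<tau>)) (t / 6) else 0)) /
                              (1 - 3 * min (Min (x ` \<tau>)) (t / 6)))"
  unfolding press_def
  by (subst sum_facets_interior[OF x]; use t in simp)+

lemma press_denominator:
  assumes x: "x \<in> realization_points K" and t: "0 \<le> t" "t \<le> 1"
  shows "1 - (\<Sum>\<tau>\<in>F. 3 * min (Min (x ` \<tau>)) (t / 6)) \<noteq> 0"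
proof (cases "{v. x v \<noteq> 0} \<in> F")
  case True
  then show ?thesis
    using sum_facets_interior[OF x refl, of "\<lambda>\<tau>. 3 * min (Min (x ` \<tau>)) (t / 6)"] t by auto
next
  case False
  then have "\<And>\<tau>. \<tau> \<in> F \<Longrightarrow> Min (x ` \<tau>) = 0" using Min_facet_eq_0[OF x] by auto
  then show ?thesis using t by simp
qed

lemma press_in:
  assumes x: "x \<in> realization_points K" and t: "0 \<le> t" "t \<le> 1"
  shows "press F t x \<in> realization_points K"
    and "2 * depth F x \<le> t \<Longrightarrow> press F t x \<in> realization_points (K - F)"
proof -
  have "press F t x \<in> realization_points K \<and>
        (2 * depth F x \<le> t \<longrightarrow> press F t x \<in> realization_points (K - F))"
  proof (cases "{v. x v \<noteq> 0} \<in> F")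
    case False
    then have "x \<in> realization_points (K - F)" using x by (auto simp: realization_points_def)
    then show ?thesis using press_rest t x by simp
  next
    case True
    define \<tau> where "\<tau> = {v. x v \<noteq> 0}"
    let ?m = "Min (x ` \<tau>)" and ?e = "min (Min (x ` \<tau>)) (t / 6)"
    have \<tau>: "\<tau> \<in> F" "{v. x v \<noteq> 0} = \<tau>" using True by (auto simp: \<tau>_def)
    note fin = facet_finite[OF \<tau>(1)]
    have p: "press F t x = (\<lambda>v. (x v - (if v \<in> \<tau> then ?e else 0)) / (1 - 3 * ?e))"
      by (rule press_interior[OF x \<tau>(2,1) t(1)])
    have x0: "0 \<le> x v" for v using x by (simp add: realization_points_def)
    have mle: "?m \<le> x v" if "v \<in> \<tau>" for v using fin that by simp
    have pos: "1 - 3 * ?e > 0" using t by linarith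
    have out: "press F t x v = 0" if "v \<notin> \<tau>" for v
      using that \<tau>(2) by (auto simp: p)
    have "sum (press F t x) \<tau> = (\<Sum>v\<in>\<tau>. x v - ?e) / (1 - 3 * ?e)"
      unfolding p sum_divide_distrib by (rule sum.cong) auto
    also have "(\<Sum>v\<in>\<tau>. x v - ?e) = 1 - 3 * ?e"
      using x \<tau> card_facet[OF \<tau>(1)] by (simp add: sum_subtractf realization_points_def)
    finally have sum1: "sum (press F t x) \<tau> = 1" using pos by simp
    have nonneg: "0 \<le> press F t x v" for v
      using pos x0[of v] mle[of v] by (auto simp: p)
    have K: "press F t x \<in> realization_points K"
      by (rule realization_pointsI[OF complex, of \<tau>]) (use \<tau> facets_subset nonneg out sum1 in auto)
    \<comment> \<open>Now the whole least coordinate is subtracted, so a vertex drops out of the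
      support; fewer than three vertices cannot form a member of \<open>F\<close>.\<close>
    moreover have "press F t x \<in> realization_points (K - F)" if "2 * depth F x \<le> t"
    proof -
      have "depth F x = 3 * ?m"
        unfolding depth_def by (rule sum_facets_interior[OF x \<tau>(2,1)]) auto
      then have "?e = ?m" using that by simp
      have "?m \<in> x ` \<tau>" using fin by simp
      then obtain v where "v \<in> \<tau>" "x v = ?m" by (metis imageE)
      then have "press F t x v = 0" using \<open>?e = ?m\<close> by (simp add: p)
      then have sub: "{v. press F t x v \<noteq> 0} \<subset> \<tau>" using out \<open>v \<in> \<tau>\<close> by blast
      then have "card {v. press F t x v \<noteq> 0} < 3"
        using card_facet[OF \<tau>(1)] fin psubset_card_mono by metis
      then have "{v. press F t x v \<noteq> 0} \<notin> F" using card_facet by force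
      then show ?thesis using K by (simp add: realization_points_def)
    qed
    ultimately show ?thesis by simp
  qed
  then show "press F t x \<in> realization_points K"
    "2 * depth F x \<le> t \<Longrightarrow> press F t x \<in> realization_points (K - F)" by auto
qed

text \<open>On a facet \<open>\<tau>\<close> this is the retraction of \<open>{0..1} \<times> \<tau>\<close> onto its bottom and sides, followed by
  the given homotopy on the sides: \<open>max 0 (t - 2 * depth F x)\<close> is the first component of the
  retraction and \<open>press F t x\<close> the second.\<close>

lemma homotopy_extension:
  assumes h: "continuous_map (prod_topology (top_of_set {0..1::real}) (geometric_realization (K - F)))
                (geometric_realization (K - F)) h"
    and h0: "\<And>x. x \<in> realization_points (K - F) \<Longrightarrow> h (0, x) = x"
  obtains H where
    "continuous_map (prod_topology (top_of_set {0..1::real}) (geometric_realization K))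
       (geometric_realization K) H"
    "\<And>x. x \<in> realization_points K \<Longrightarrow> H (0, x) = x"
    "\<And>t x. t \<in> {0..1} \<Longrightarrow> x \<in> realization_points (K - F) \<Longrightarrow> H (t, x) = h (t, x)"
proof
  let ?I = "top_of_set {0..1::real}"
  let ?X = "prod_topology ?I (geometric_realization K)"
  let ?C = "geometric_realization (K - F)"
  let ?H = "\<lambda>z. if 2 * depth F (snd z) \<le> fst z
                then h (fst z - 2 * depth F (snd z), press F (fst z) (snd z))
                else press F (fst z) (snd z)"
  have cfst: "continuous_map ?X euclideanreal fst"
    using continuous_map_fst continuous_map_in_subtopology by blast
  have csnd: "continuous_map ?X euclideanreal (\<lambda>z. snd z v)" for v
    by (rule continuous_map_coordinate_comp[OF continuous_map_snd])
  have cMin: "continuous_map ?X euclideanreal (\<lambda>z. Min (snd z ` \<tau>))" if "\<tau> \<in> F" for \<tau>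
    by (rule continuous_map_Min) (use facet_finite[OF that] csnd in auto)
  have cdepth: "continuous_map ?X euclideanreal (\<lambda>z. depth F (snd z))"
    unfolding depth_def
    by (intro continuous_map_sum finite_facets continuous_map_real_mult_left cMin)
  have cmin: "continuous_map ?X euclideanreal (\<lambda>z. min (Min (snd z ` \<tau>)) (fst z / 6))" if "\<tau> \<in> F" for \<tau>
    by (intro continuous_map_real_min continuous_map_real_divide cMin that cfst) auto
  have cpress: "continuous_map ?X euclideanreal (\<lambda>z. press F (fst z) (snd z) v)" for v
    unfolding press_def
    by (intro continuous_map_real_divide continuous_map_diff continuous_map_sum finite_facets
         csnd continuous_map_if_const cmin continuous_map_real_mult_left) (use press_denominator in auto)
  have cpressK: "continuous_map ?X (geometric_realization K) (\<lambda>z. press F (fst z) (snd z))"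
    unfolding continuous_map_into_realization using cpress press_in(1) by auto
  let ?S = "{z \<in> topspace ?X. 2 * depth F (snd z) \<le> fst z}"
  have "continuous_map (subtopology ?X ?S) (prod_topology ?I ?C)
          (\<lambda>z. (fst z - 2 * depth F (snd z), press F (fst z) (snd z)))"
  proof (rule continuous_map_pairedI)
    show "continuous_map (subtopology ?X ?S) ?I (\<lambda>z. fst z - 2 * depth F (snd z))"
      unfolding continuous_map_in_subtopology
    proof
      show "continuous_map (subtopology ?X ?S) euclideanreal (\<lambda>z. fst z - 2 * depth F (snd z))"
        by (intro continuous_map_diff continuous_map_from_subtopology cfst
              continuous_map_real_mult_left cdepth)
      have "fst z - 2 * depth F (snd z) \<in> {0..1}" if "z \<in> ?S" for z
        using that depth_nonneg[of "snd z"] by auto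
      then show "(\<lambda>z. fst z - 2 * depth F (snd z)) \<in> topspace (subtopology ?X ?S) \<rightarrow> {0..1}"
        by simp
    qed
    show "continuous_map (subtopology ?X ?S) ?C (\<lambda>z. press F (fst z) (snd z))"
      unfolding continuous_map_into_realization
      using press_in(2) by (auto intro: continuous_map_from_subtopology cpress)
  qed
  then have "continuous_map (subtopology ?X ?S) ?C
               (h \<circ> (\<lambda>z. (fst z - 2 * depth F (snd z), press F (fst z) (snd z))))"
    using h by (rule continuous_map_compose)
  then have "continuous_map (subtopology ?X ?S) (geometric_realization K)
               (\<lambda>z. h (fst z - 2 * depth F (snd z), press F (fst z) (snd z)))"
    unfolding continuous_map_into_realization using rest_subset by (auto simp: comp_def)
  then show "continuous_map ?X (geometric_realization K) ?H"
  proof (rule continuous_map_cases_le[rotated 2])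
    fix z assume "z \<in> topspace ?X" "2 * depth F (snd z) = fst z"
    then show "h (fst z - 2 * depth F (snd z), press F (fst z) (snd z)) = press F (fst z) (snd z)"
      using h0 press_in(2)[of "snd z" "fst z"] by auto
  qed (intro continuous_map_from_subtopology cpressK continuous_map_real_mult_left cdepth cfst)+
  show "?H (0, x) = x" if x: "x \<in> realization_points K" for x
  proof (cases "depth F x = 0")
    case True
    then have "press F 0 x \<in> realization_points (K - F)" using press_in(2)[OF x, of 0] by simp
    then show ?thesis using True h0 press_0[OF x] by simp
  next
    case False
    then show ?thesis using depth_nonneg[OF x] press_0[OF x] by simp
  qed
  show "?H (t, x) = h (t, x)" if "t \<in> {0..1}" "x \<in> realization_points (K - F)" for t x
    using that depth_rest press_rest by simp
qed

end

section \<open>Mapping a triangle onto the sphere\<close>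

text \<open>Inverse stereographic projection of \<open>(a - c, b - c) / min a b c\<close> on the triangle
  \<open>a + b + c = 1\<close>, cleared of denominators; the boundary goes to the pole.  The last summand of
  \<open>sphere_height\<close> only serves to keep the denominator nonzero away from that triangle.\<close>

definition sphere_height :: "real \<Rightarrow> real \<Rightarrow> real \<Rightarrow> real" where
  "sphere_height a b c = (a - c)\<^sup>2 + (b - c)\<^sup>2 + (1 - (a + b + c))\<^sup>2"

definition triangle_to_sphere :: "real \<Rightarrow> real \<Rightarrow> real \<Rightarrow> nat \<Rightarrow> real" where
  "triangle_to_sphere a b c =
     (let m = min a (min b c); D = sphere_height a b c
      in (\<lambda>k. if k = 0 then (D - m\<^sup>2) / (D + m\<^sup>2)
              else if k = 1 then 2 * (a - c) * m / (D + m\<^sup>2)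
              else if k = 2 then 2 * (b - c) * m / (D + m\<^sup>2) else 0))"

lemma triangle_to_sphere_coordinates:
  fixes a b c
  defines "m \<equiv> min a (min b c)" and "D \<equiv> sphere_height a b c"
  shows "triangle_to_sphere a b c 0 = (D - m\<^sup>2) / (D + m\<^sup>2)"
    "triangle_to_sphere a b c 1 = 2 * (a - c) * m / (D + m\<^sup>2)"
    "triangle_to_sphere a b c 2 = 2 * (b - c) * m / (D + m\<^sup>2)"
  by (simp_all add: triangle_to_sphere_def Let_def m_def D_def)

abbreviation sphere_pole :: "nat \<Rightarrow> real" where
  "sphere_pole \<equiv> (\<lambda>k. if k = 0 then 1 else 0)"

lemma in_nsphere_2:
  "x \<in> topspace (nsphere 2) \<longleftrightarrow> (x 0)\<^sup>2 + (x 1)\<^sup>2 + (x 2)\<^sup>2 = 1 \<and> (\<forall>k>2. x k = 0)"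
  by (simp add: nsphere numeral_2_eq_2)

text \<open>If all four squares vanished, then \<open>a = b = c\<close> with minimum 0, so all three
  would be 0, against \<open>a + b + c = 1\<close>.\<close>

lemma sphere_denom_pos:
  assumes "0 \<le> a" "0 \<le> b" "0 \<le> c"
  shows "0 < sphere_height a b c + (min a (min b c))\<^sup>2"
proof (rule ccontr)
  assume "\<not> ?thesis"
  moreover have "0 \<le> (a - c)\<^sup>2" "0 \<le> (b - c)\<^sup>2" "0 \<le> (1 - (a + b + c))\<^sup>2" "0 \<le> (min a (min b c))\<^sup>2"
    by auto
  ultimately have "(a - c)\<^sup>2 = 0" "(b - c)\<^sup>2 = 0" "(1 - (a + b + c))\<^sup>2 = 0" "(min a (min b c))\<^sup>2 = 0"
    unfolding sphere_height_def by linarith+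
  then show False by (auto simp: min_def split: if_splits)
qed

lemma triangle_to_sphere_boundary:
  assumes "0 \<le> a" "0 \<le> b" "0 \<le> c" "min a (min b c) = 0"
  shows "triangle_to_sphere a b c = sphere_pole"
  using sphere_denom_pos[OF assms(1-3)] assms(4)
  by (auto simp: triangle_to_sphere_def fun_eq_iff Let_def)

lemma triangle_to_sphere_in:
  assumes "0 \<le> a" "0 \<le> b" "0 \<le> c" "a + b + c = 1 \<or> min a (min b c) = 0"
  shows "triangle_to_sphere a b c \<in> topspace (nsphere 2)"
proof (cases "min a (min b c) = 0")
  case True
  then show ?thesis using triangle_to_sphere_boundary[OF assms(1-3)] by (simp add: in_nsphere_2)
next
  case False
  let ?m = "min a (min b c)" and ?D = "sphere_height a b c"
  have D: "?D = (a - c)\<^sup>2 + (b - c)\<^sup>2" using assms False by (simp add: sphere_height_def)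
  have "(?D - ?m\<^sup>2)\<^sup>2 + (2 * (a - c) * ?m)\<^sup>2 + (2 * (b - c) * ?m)\<^sup>2 = (?D + ?m\<^sup>2)\<^sup>2"
    unfolding D by algebra
  then have "((?D - ?m\<^sup>2)/(?D + ?m\<^sup>2))\<^sup>2 + (2 * (a - c) * ?m/(?D + ?m\<^sup>2))\<^sup>2 + (2 * (b - c) * ?m/(?D + ?m\<^sup>2))\<^sup>2 = 1"
    using sphere_denom_pos[OF assms(1-3)]
    by (simp add: power_divide flip: add_divide_distrib)
  then show ?thesis by (simp add: in_nsphere_2 triangle_to_sphere_def Let_def)
qed

lemma triangle_to_sphere_interior_ne:
  assumes "0 < a" "0 < b" "0 < c"
  shows "triangle_to_sphere a b c 0 < 1"
  using sphere_denom_pos[of a b c] assms by (simp add: triangle_to_sphere_def Let_def divide_simps min_def)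

text \<open>Coordinate 0 determines \<open>r\<close>, and then coordinates 1 and 2 determine the
  stereographic coordinates \<open>(a - c) / m\<close> and \<open>(b - c) / m\<close>. Since
  \<open>m - c\<close> is a function of the differences that scales with them, the triple is
  determined up to a positive factor \<open>k\<close>, and the normalization of the sums forces
  \<open>k = 1\<close>.\<close>

lemma triangle_to_sphere_inj:
  assumes "0 < a" "0 < b" "0 < c" "a + b + c = 1" "0 < a'" "0 < b'" "0 < c'" "a' + b' + c' = 1"
    and eq: "triangle_to_sphere a b c = triangle_to_sphere a' b' c'"
  shows "a = a' \<and> b = b' \<and> c = c'"
proof -
  define m D m' D' where defs: "m = min a (min b c)" "D = sphere_height a b c"
    "m' = min a' (min b' c')" "D' = sphere_height a' b' c'"
  have pos: "0 < D + m\<^sup>2" "0 < D' + m'\<^sup>2" "0 < m" "0 < m'"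
    using sphere_denom_pos[of a b c] sphere_denom_pos[of a' b' c'] assms by (auto simp: defs)
  define r where "r = m\<^sup>2 / (D + m\<^sup>2)"
  have rpos: "r > 0" using pos by (simp add: r_def)
  have f: "(D - m\<^sup>2) / (D + m\<^sup>2) = 1 - 2 * r" "(D' - m'\<^sup>2) / (D' + m'\<^sup>2) = 1 - 2 * (m'\<^sup>2 / (D' + m'\<^sup>2))"
    unfolding r_def using pos by (auto simp: field_simps)
  have e: "(D - m\<^sup>2) / (D + m\<^sup>2) = (D' - m'\<^sup>2) / (D' + m'\<^sup>2)"
    "2 * (a - c) * m / (D + m\<^sup>2) = 2 * (a' - c') * m' / (D' + m'\<^sup>2)"
    "2 * (b - c) * m / (D + m\<^sup>2) = 2 * (b' - c') * m' / (D' + m'\<^sup>2)"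
    using fun_cong[OF eq, of 0] fun_cong[OF eq, of 1] fun_cong[OF eq, of 2]
    unfolding triangle_to_sphere_coordinates defs by this+
  have "1 - 2 * x = 1 - 2 * y \<Longrightarrow> x = y" for x y :: real by linarith
  then have r': "r = m'\<^sup>2 / (D' + m'\<^sup>2)" using e(1) unfolding f .
  have nz: "m \<noteq> 0" "m' \<noteq> 0" using pos(3,4) by auto
  have frac: "2 * u * w / E = 2 * (w\<^sup>2 / E) * (u / w)" if "w \<noteq> 0" for u w E :: real
    using that by (simp add: power2_eq_square)
  have "2 * (a - c) * m / (D + m\<^sup>2) = 2 * r * ((a - c) / m)"
    "2 * (b - c) * m / (D + m\<^sup>2) = 2 * r * ((b - c) / m)"
    unfolding r_def by (rule frac; use nz in simp)+
  moreover have "2 * (a' - c') * m' / (D' + m'\<^sup>2) = 2 * r * ((a' - c') / m')"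
    "2 * (b' - c') * m' / (D' + m'\<^sup>2) = 2 * r * ((b' - c') / m')"
    unfolding r' by (rule frac; use nz in simp)+
  moreover have "2 * r * x = 2 * r * y \<Longrightarrow> x = y" for x y using rpos by simp
  ultimately have q: "(a - c) / m = (a' - c') / m'" "(b - c) / m = (b' - c') / m'"
    using e(2,3) by presburger+
  define k where "k = m' / m"
  have k: "k > 0" "m' = k * m" "a' - c' = k * (a - c)" "b' - c' = k * (b - c)"
    using pos q by (auto simp: k_def field_simps)
  have mm: "m = c + min (a - c) (min (b - c) 0)" "m' = c' + min (a' - c') (min (b' - c') 0)"
    by (auto simp: defs)
  have "min (k * (a - c)) (min (k * (b - c)) 0) = k * min (a - c) (min (b - c) 0)"
    using k(1) by (simp add: min_mult_distrib_left)
  then have "c' = k * c" using mm k by (simp add: algebra_simps)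
  then have "a' = k * a" "b' = k * b" using k by (simp_all add: algebra_simps)
  then have "k * (a + b + c) = a' + b' + c'" using \<open>c' = k * c\<close> by (simp add: algebra_simps)
  then have "k = 1" unfolding assms(4,8) by simp
  then show ?thesis using \<open>a' = k * a\<close> \<open>b' = k * b\<close> \<open>c' = k * c\<close> by simp
qed

lemma triangle_to_sphere_surj:
  assumes y: "y \<in> topspace (nsphere 2)"
  obtains a b c where "0 \<le> a" "0 \<le> b" "0 \<le> c" "a + b + c = 1" "triangle_to_sphere a b c = y"
proof (cases "y = sphere_pole")
  case True
  show ?thesis
    by (rule that[of 1 0 0]) (use True triangle_to_sphere_boundary[of 1 0 0] in auto)
next
  case False
  have y2: "(y 0)\<^sup>2 + (y 1)\<^sup>2 + (y 2)\<^sup>2 = 1" and y3: "\<And>k. k > 2 \<Longrightarrow> y k = 0" using y by (auto simp: in_nsphere_2)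
  have "y 0 < 1"
  proof (rule ccontr)
    assume "\<not> y 0 < 1"
    then have "(y 0)\<^sup>2 \<ge> 1" by simp
    then have sq: "(y 1)\<^sup>2 = 0" "(y 2)\<^sup>2 = 0" "(y 0)\<^sup>2 = 1"
      using y2 zero_le_power2[of "y 1"] zero_le_power2[of "y 2"] by linarith+
    then have y12: "y 1 = 0" "y 2 = 0" by simp_all
    have y0: "y 0 = 1" using sq(3) \<open>\<not> y 0 < 1\<close> unfolding power2_eq_1_iff by linarith
    have "y = sphere_pole"
    proof
      fix k :: nat
      consider "k = 0" | "k = 1" | "k = 2" | "k > 2" by linarith
      then show "y k = sphere_pole k" by cases (use y0 y12 y3 in simp_all)
    qed
    then show False using False by simp
  qed
  \<comment> \<open>The pair \<open>(p, q)\<close> is the stereographic projection of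
    \<open>y\<close> from the pole.\<close>
  define s p q where "s = 1 - y 0" and "p = y 1 / s" and "q = y 2 / s"
  have s: "s > 0" using \<open>y 0 < 1\<close> by (simp add: s_def)
  \<comment> \<open>The triple \<open>(p + 1 - l, q + 1 - l, 1 - l)\<close> has minimum 1 and
    differences \<open>p\<close> and \<open>q\<close> to its last entry. Multiplying by
    \<open>m\<close> makes the sum 1 and turns the minimum into \<open>m\<close>, so the
    stereographic coordinates of the result are \<open>p\<close> and \<open>q\<close>.\<close>
  define l where "l = min p (min q 0)"
  define m where "m = 1 / (p + q + 3 - 3 * l)"
  have l: "l \<le> p" "l \<le> q" "l \<le> 0" "min (p - l) (min (q - l) (- l)) = 0"
    by (auto simp: l_def min_def)
  have mpos: "m > 0" using l by (simp add: m_def)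
  define a b c where "a = m * (p + 1 - l)" and "b = m * (q + 1 - l)" and "c = m * (1 - l)"
  have nonneg: "0 \<le> a" "0 \<le> b" "0 \<le> c" using mpos l by (auto simp: a_def b_def c_def)
  have "a + b + c = m * (p + q + 3 - 3 * l)" by (simp add: a_def b_def c_def algebra_simps)
  then have sum: "a + b + c = 1" using l by (simp add: m_def)
  have min_m: "min a (min b c) = m"
  proof -
    have "min (p + 1 - l) (min (q + 1 - l) (1 - l)) = 1" using l(4) by linarith
    moreover have "min a (min b c) = m * min (p + 1 - l) (min (q + 1 - l) (1 - l))"
      using mpos unfolding a_def b_def c_def by (subst min_mult_distrib_left, simp)+
    ultimately show ?thesis by simp
  qed
  have ac: "a - c = m * p" "b - c = m * q" by (simp_all add: a_def b_def c_def algebra_simps)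
  have D: "sphere_height a b c = m\<^sup>2 * (p\<^sup>2 + q\<^sup>2)"
    using sum by (simp add: sphere_height_def ac power_mult_distrib algebra_simps)
  have "s\<^sup>2 * (p\<^sup>2 + q\<^sup>2) = (y 1)\<^sup>2 + (y 2)\<^sup>2" using s by (simp add: p_def q_def power_divide field_simps)
  also have "\<dots> = s * (1 + y 0)" using y2 by (simp add: s_def algebra_simps power2_eq_square)
  finally have "s * (p\<^sup>2 + q\<^sup>2) = 1 + y 0" using s by (simp add: power2_eq_square)
  then have pq: "p\<^sup>2 + q\<^sup>2 = (1 + y 0) / s" using s by (simp add: field_simps)
  have S: "p\<^sup>2 + q\<^sup>2 + 1 = 2 / s" "p\<^sup>2 + q\<^sup>2 - 1 = 2 * y 0 / s"
    unfolding pq using s by (simp_all add: divide_simps) (simp_all add: s_def)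
  have den: "sphere_height a b c + m\<^sup>2 = m\<^sup>2 * (2 / s)" "sphere_height a b c - m\<^sup>2 = m\<^sup>2 * (2 * y 0 / s)"
    unfolding D S[symmetric] by (simp_all add: algebra_simps)
  have "triangle_to_sphere a b c = y"
  proof
    fix k :: nat
    consider "k = 0" | "k = 1" | "k = 2" | "k > 2" by linarith
    then show "triangle_to_sphere a b c k = y k"
    proof cases
      case 1
      then show ?thesis
        using s mpos by (simp only: triangle_to_sphere_coordinates min_m den) (simp add: field_simps)
    next
      case 2
      then show ?thesis
        using s mpos by (simp only: triangle_to_sphere_coordinates min_m den ac)
          (simp add: p_def power2_eq_square)
    next
      case 3
      then show ?thesis
        using s mpos by (simp only: triangle_to_sphere_coordinates min_m den ac)
          (simp add: q_def power2_eq_square)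
    next
      case 4
      then show ?thesis using y3 by (simp add: triangle_to_sphere_def Let_def)
    qed
  qed
  then show ?thesis using that nonneg sum by blast
qed

section \<open>Triangles attached to a contractible complex\<close>

lemma Hausdorff_nsphere: "Hausdorff_space (nsphere n)"
  by (simp add: nsphere Hausdorff_space_subtopology Hausdorff_space_product_topology)

lemma continuous_map_triangle_to_sphere:
  assumes cont: "continuous_map X euclideanreal f" "continuous_map X euclideanreal g"
      "continuous_map X euclideanreal h"
    and nonneg: "\<And>x. x \<in> topspace X \<Longrightarrow> 0 \<le> f x \<and> 0 \<le> g x \<and> 0 \<le> h x"
    and triangle: "\<And>x. x \<in> topspace X \<Longrightarrow> f x + g x + h x = 1 \<or> min (f x) (min (g x) (h x)) = 0"
  shows "continuous_map X (nsphere 2) (\<lambda>x. triangle_to_sphere (f x) (g x) (h x))"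
proof -
  have den: "sphere_height (f x) (g x) (h x) + (min (f x) (min (g x) (h x)))\<^sup>2 \<noteq> 0"
    if "x \<in> topspace X" for x
    using sphere_denom_pos[of "f x" "g x" "h x"] nonneg[OF that] by linarith
  have height: "continuous_map X euclideanreal (\<lambda>x. sphere_height (f x) (g x) (h x))"
    unfolding sphere_height_def
    by (intro continuous_map_add continuous_map_diff continuous_map_real_pow cont) simp
  have m: "continuous_map X euclideanreal (\<lambda>x. min (f x) (min (g x) (h x)))"
    by (intro continuous_map_real_min cont)
  note frac = continuous_map_real_divide continuous_map_add continuous_map_diff
    continuous_map_real_pow continuous_map_real_mult height m cont den
  have "continuous_map X euclideanreal (\<lambda>x. triangle_to_sphere (f x) (g x) (h x) k)" for k
  proof -
    consider "k = 0" | "k = 1" | "k = 2" | "k > 2" by linarith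
    then show ?thesis
    proof cases
      case 4
      then show ?thesis by (simp add: triangle_to_sphere_def Let_def)
    qed (simp only: triangle_to_sphere_coordinates, intro frac; simp)+
  qed
  moreover have "triangle_to_sphere (f x) (g x) (h x) \<in> topspace (nsphere 2)" if "x \<in> topspace X" for x
    using triangle_to_sphere_in[of "f x" "g x" "h x"] nonneg[OF that] triangle[OF that] by blast
  ultimately show ?thesis
    unfolding nsphere by (auto simp: continuous_map_in_subtopology continuous_map_componentwise_UNIV)
qed

context triangle_facets
begin

text \<open>A closed triangle is cut out of a product of compact intervals and points by the closed
  condition that the coordinates sum to 1. Its compactness is what later makes images of closed sets
  in the sphere closed.\<close>

lemma compactin_facet:
  assumes "\<tau> \<in> F"
  shows "compactin (geometric_realization K) {x \<in> realization_points K. {v. x v \<noteq> 0} \<subseteq> \<tau>}"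
proof -
  let ?B = "PiE UNIV (\<lambda>v. if v \<in> \<tau> then {0..1::real} else {0})"
  let ?S = "{x \<in> topspace (powertop_real UNIV). sum x \<tau> \<in> {1::real}}"
  have fin: "finite \<tau>" using facet_finite assms by blast
  have "{x \<in> realization_points K. {v. x v \<noteq> 0} \<subseteq> \<tau>} = ?S \<inter> ?B"
  proof (intro equalityI subsetI)
    fix x assume x: "x \<in> {x \<in> realization_points K. {v. x v \<noteq> 0} \<subseteq> \<tau>}"
    then have sum: "sum x \<tau> = 1" using realization_points_sum[OF _ fin] by blast
    have nonneg: "0 \<le> x v" for v using x by (simp add: realization_points_def)
    have "x v \<le> 1" if "v \<in> \<tau>" for v
      using member_le_sum[OF that _ fin, of x] nonneg sum by simp
    then show "x \<in> ?S \<inter> ?B" using x sum nonneg by auto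
  next
    fix x assume x: "x \<in> ?S \<inter> ?B"
    then have xv: "x v \<in> (if v \<in> \<tau> then {0..1::real} else {0})" for v by (auto simp: PiE_iff)
    have "0 \<le> x v" "v \<notin> \<tau> \<Longrightarrow> x v = 0" for v using xv[of v] by (auto split: if_splits)
    moreover have "\<tau> \<in> K" using assms facets_subset by blast
    ultimately show "x \<in> {x \<in> realization_points K. {v. x v \<noteq> 0} \<subseteq> \<tau>}"
      using realization_pointsI[OF complex, of \<tau> x] x by auto
  qed
  moreover have "compactin (powertop_real UNIV) (?S \<inter> ?B)"
  proof (rule closed_Int_compactin)
    show "closedin (powertop_real UNIV) ?S"
      by (rule closedin_continuous_map_preimage[where Y = euclideanreal])
        (auto intro!: continuous_map_sum fin continuous_map_product_projection)
    show "compactin (powertop_real UNIV) ?B"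
      by (auto simp: compactin_PiE)
  qed
  ultimately show ?thesis
    by (auto simp: geometric_realization_eq compactin_subtopology)
qed

text \<open>The map \<open>q\<close> crushes the realization of \<open>K - F\<close> to the base
  point and wraps the \<open>i\<close>-th triangle around the \<open>i\<close>-th sphere, so the
  wedge is the quotient by a contractible subspace. \<open>homotopy_extension\<close> extends the
  contraction to the whole complex, as \<open>quotient_homotopy_equivalent\<close> requires.\<close>

theorem homotopy_equivalent_wedge:
  assumes contr: "contractible_space (geometric_realization (K - F))" and ne: "K - F \<noteq> {}"
  shows "geometric_realization K homotopy_equivalent_space wedge_of_2_spheres (card F)"
proof -
  let ?X = "geometric_realization K" and ?S = "nsphere 2" and ?n = "card F"
  let ?W = "wedge_of_2_spheres ?n" and ?wm = "wedge_map (\<lambda>_::nat. sphere_pole)"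
  have top_W: "topspace ?W = wedge_points (\<lambda>_. ?S) (\<lambda>_. sphere_pole) {..<?n}"
    by (simp add: wedge_of_2_spheres_def topspace_wedge)
  have open_W: "openin ?W U \<longleftrightarrow> U \<subseteq> topspace ?W \<and> (\<forall>i<?n. openin ?S {y \<in> topspace ?S. ?wm i y \<in> U})" for U
    by (auto simp: wedge_of_2_spheres_def openin_wedge topspace_wedge)
  obtain e where e: "bij_betw e {..<?n} F"
    using ex_bij_betw_nat_finite[OF finite_facets] by (auto simp: atLeast0LessThan)
  have eF: "e i \<in> F" if "i < ?n" for i using e that by (auto simp: bij_betw_def)
  have e_inj: "i = j" if "e i = e j" "i < ?n" "j < ?n" for i j
    using e that by (auto simp: bij_betw_def inj_on_def)
  have e_surj: "\<exists>i<?n. e i = \<tau>" if "\<tau> \<in> F" for \<tau>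
  proof -
    have "\<tau> \<in> e ` {..<?n}" using that by (simp only: bij_betw_imp_surj_on[OF e])
    then show ?thesis by blast
  qed
  have "\<exists>t. e i = {fst t, fst (snd t), snd (snd t)} \<and> fst t \<noteq> fst (snd t) \<and>
          fst t \<noteq> snd (snd t) \<and> fst (snd t) \<noteq> snd (snd t)" if i: "i < ?n" for i
  proof -
    obtain a b c where "e i = {a, b, c}" "a \<noteq> b" "a \<noteq> c" "b \<noteq> c"
      using card_facet[OF eF[OF i]] unfolding card_3_iff by (elim exE conjE)
    then show ?thesis by (intro exI[of _ "(a, b, c)"]) simp
  qed
  then obtain f where f: "\<And>i. i < ?n \<Longrightarrow> e i = {fst (f i), fst (snd (f i)), snd (snd (f i))} \<and>
      fst (f i) \<noteq> fst (snd (f i)) \<and> fst (f i) \<noteq> snd (snd (f i)) \<and> fst (snd (f i)) \<noteq> snd (snd (f i))"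
    by metis
  define va vb vc where "va i = fst (f i)" and "vb i = fst (snd (f i))" and "vc i = snd (snd (f i))" for i
  have abc: "e i = {va i, vb i, vc i}" and dist: "va i \<noteq> vb i \<and> va i \<noteq> vc i \<and> vb i \<noteq> vc i" if "i < ?n" for i
    using f[OF that] by (simp_all add: va_def vb_def vc_def)
  define \<phi> where "\<phi> i x = triangle_to_sphere (x (va i)) (x (vb i)) (x (vc i))" for i and x :: "'a \<Rightarrow> real"
  define ix where "ix \<tau> = (THE i. i < ?n \<and> e i = \<tau>)" for \<tau>
  define q where "q x = (if {v. x v \<noteq> 0} \<in> F then Some (ix {v. x v \<noteq> 0}, \<phi> (ix {v. x v \<noteq> 0}) x) else None)"
    for x
  have ix: "ix (e i) = i" if "i < ?n" for i
    unfolding ix_def using that e_inj by (intro the_equality) auto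
  have nonneg: "0 \<le> x v" if "x \<in> realization_points K" for x v
    using that by (simp add: realization_points_def)
  have Min_abc: "Min (x ` e i) = min (x (va i)) (min (x (vb i)) (x (vc i)))" if "i < ?n" for x :: "'a \<Rightarrow> real" and i
    by (simp add: abc[OF that])
  have sum_abc: "x (va i) + x (vb i) + x (vc i) = 1"
    if "x \<in> realization_points K" "{v. x v \<noteq> 0} \<subseteq> e i" "i < ?n" for x i
  proof -
    have "sum x (e i) = 1" using realization_points_sum[OF that(1) _ that(2)] facet_finite[OF eF[OF that(3)]] by blast
    then show ?thesis using dist[OF that(3)] by (simp add: abc[OF that(3)])
  qed
  have boundary: "min (x (va i)) (min (x (vb i)) (x (vc i))) = 0"
    if "x \<in> realization_points K" "{v. x v \<noteq> 0} \<noteq> e i" "i < ?n" for x i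
    using Min_facet_eq_0[OF that(1) eF that(2)] that(3) by (simp add: Min_abc)
  have \<phi>_cont: "continuous_map ?X ?S (\<phi> i)" if "i < ?n" for i
    unfolding \<phi>_def
  proof (rule continuous_map_triangle_to_sphere)
    fix x assume "x \<in> topspace ?X"
    then show "x (va i) + x (vb i) + x (vc i) = 1 \<or> min (x (va i)) (min (x (vb i)) (x (vc i))) = 0"
      using sum_abc[of x i] boundary[of x i] that by auto
  qed (auto intro: continuous_map_coordinate nonneg)
  have \<phi>_in: "\<phi> i x \<in> topspace ?S" if "x \<in> realization_points K" "i < ?n" for x i
    using \<phi>_cont[OF that(2)] that(1) by (auto simp: continuous_map_def)
  have \<phi>_pole: "\<phi> i x = sphere_pole" if "x \<in> realization_points K" "{v. x v \<noteq> 0} \<noteq> e i" "i < ?n" for x i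
    unfolding \<phi>_def by (rule triangle_to_sphere_boundary) (use that nonneg boundary in auto)
  have pos: "0 < x (va i)" "0 < x (vb i)" "0 < x (vc i)"
    if "x \<in> realization_points K" "{v. x v \<noteq> 0} = e i" "i < ?n" for x i
  proof -
    have "x (va i) \<noteq> 0" "x (vb i) \<noteq> 0" "x (vc i) \<noteq> 0"
      using that(2) unfolding abc[OF that(3)] by blast+
    then show "0 < x (va i)" "0 < x (vb i)" "0 < x (vc i)"
      using nonneg[OF that(1)] by (simp_all add: order_less_le)
  qed
  have \<phi>_ne: "\<phi> i x \<noteq> sphere_pole" if "x \<in> realization_points K" "{v. x v \<noteq> 0} = e i" "i < ?n" for x i
    using triangle_to_sphere_interior_ne[OF pos[OF that]] unfolding \<phi>_def by (metis less_irrefl)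
  have q_interior: "q x = Some (i, \<phi> i x)" if "{v. x v \<noteq> 0} = e i" "i < ?n" for x i
    using that eF ix by (simp add: q_def)
  \<comment> \<open>This holds on the whole closed triangle: at its boundary points
    \<open>\<phi> i\<close> gives the pole, and both sides are \<open>None\<close>.\<close>
  have q_wm: "q x = ?wm i (\<phi> i x)" if x: "x \<in> realization_points K" "{v. x v \<noteq> 0} \<subseteq> e i" "i < ?n" for x i
  proof (cases "{v. x v \<noteq> 0} = e i")
    case True
    then show ?thesis using q_interior[OF True x(3)] \<phi>_ne[OF x(1) True x(3)] by (simp add: wedge_map_def)
  next
    case False
    have "e i \<in> K" using eF[OF x(3)] facets_subset by blast
    then have "{v. x v \<noteq> 0} \<notin> F" using facet_maximal[of "{v. x v \<noteq> 0}" "e i"] x(2) False by auto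
    then show ?thesis using \<phi>_pole[OF x(1) False x(3)] by (simp add: q_def wedge_map_def)
  qed
  have q_rest: "q x = None \<longleftrightarrow> {v. x v \<noteq> 0} \<notin> F" for x by (simp add: q_def)
  have lift: "\<exists>x\<in>realization_points K. {v. x v \<noteq> 0} \<subseteq> e i \<and> \<phi> i x = y" if i: "i < ?n" and y: "y \<in> topspace ?S" for i y
  proof -
    obtain a b c where abc': "0 \<le> a" "0 \<le> b" "0 \<le> c" "a + b + c = 1" "triangle_to_sphere a b c = y"
      using triangle_to_sphere_surj[OF y] by blast
    let ?x = "\<lambda>v. if v = va i then a else if v = vb i then b else if v = vc i then c else 0"
    have "?x \<in> realization_points K"
    proof (rule realization_pointsI[OF complex])
      show "e i \<in> K" using eF[OF i] facets_subset by blast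
      show "sum ?x (e i) = 1" using dist[OF i] abc' by (auto simp: abc[OF i])
    qed (use abc' abc[OF i] in auto)
    moreover have "\<phi> i ?x = y" using dist[OF i] abc' by (auto simp: \<phi>_def)
    moreover have "{v. ?x v \<noteq> 0} \<subseteq> e i" by (auto simp: abc[OF i])
    ultimately show ?thesis by (intro bexI[of _ ?x] conjI)
  qed
  have quot: "quotient_map ?X ?W q"
    unfolding quotient_map_def
  proof (intro conjI allI impI)
    have q_in: "q x \<in> topspace ?W" if x: "x \<in> realization_points K" for x
    proof (cases "{v. x v \<noteq> 0} \<in> F")
      case True
      then obtain i where i: "i < ?n" "e i = {v. x v \<noteq> 0}" using e_surj by blast
      then have "q x = ?wm i (\<phi> i x)" using q_wm[OF x] by blast
      then show ?thesis using \<phi>_in[OF x i(1)] i(1) by (auto simp: top_W wedge_points_def)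
    qed (simp add: q_def top_W wedge_points_def)
    \<comment> \<open>The base point must be attained even if there are no triangles; any vertex of
      \<open>K - F\<close> provides a preimage.\<close>
    have "None \<in> q ` realization_points K"
    proof -
      obtain \<sigma> where \<sigma>: "\<sigma> \<in> K - F" using ne by blast
      have "\<sigma> \<noteq> {}" using complex_rest \<sigma> unfolding abstract_complex_def by blast
      then obtain v where "v \<in> \<sigma>" by blast
      then have v: "{v} \<in> K - F" using abstract_complex_face[OF complex_rest \<sigma>, of "{v}"] by blast
      let ?x = "\<lambda>w. if w = v then 1 else (0::real)"
      have "?x \<in> realization_points (K - F)"
        by (rule realization_pointsI[OF complex_rest v]) auto
      then have "?x \<in> realization_points K" "{w. ?x w \<noteq> 0} \<notin> F"
        unfolding realization_points_def by blast+
      then have "?x \<in> realization_points K" "None = q ?x" by (simp_all only: q_def if_False)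
      then show ?thesis by (intro image_eqI[of None q ?x])
    qed
    moreover have "?wm i y \<in> q ` realization_points K" if "i < ?n" "y \<in> topspace ?S" for i y
    proof -
      from lift[OF that]
      obtain x where "x \<in> realization_points K" "{v. x v \<noteq> 0} \<subseteq> e i" "\<phi> i x = y"
        by (elim bexE conjE)
      then show ?thesis using q_wm[of x i] that(1) by (intro image_eqI[of _ q x]) simp_all
    qed
    ultimately have "topspace ?W \<subseteq> q ` realization_points K"
      unfolding top_W wedge_points_def by blast
    then show "q ` topspace ?X = topspace ?W"
      using q_in by (intro equalityI image_subsetI) simp_all
    fix U assume U: "U \<subseteq> topspace ?W"
    let ?V = "\<lambda>i. {y \<in> topspace ?S. ?wm i y \<in> U}"
    show "openin ?X {x \<in> topspace ?X. q x \<in> U} = openin ?W U"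
    proof
      assume opn: "openin ?X {x \<in> topspace ?X. q x \<in> U}"
      have "openin ?S (?V i)" if i: "i < ?n" for i
      proof -
        \<comment> \<open>The complement is treated instead: its preimage in the closed triangle is
          compact, so the image under \<open>\<phi> i\<close> is closed in the Hausdorff
          sphere.\<close>
        let ?C = "(topspace ?X - {x \<in> topspace ?X. q x \<in> U}) \<inter> {x \<in> realization_points K. {v. x v \<noteq> 0} \<subseteq> e i}"
        have "compactin ?X ?C"
          by (rule closed_Int_compactin[OF closedin_diff[OF closedin_topspace opn]
                compactin_facet[OF eF[OF i]]])
        then have "compactin ?S (\<phi> i ` ?C)"
          by (rule image_compactin[OF _ \<phi>_cont[OF i]])
        then have closed: "closedin ?S (\<phi> i ` ?C)"
          by (rule compactin_imp_closedin[OF Hausdorff_nsphere])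
        have "\<phi> i ` ?C = topspace ?S - ?V i"
        proof (intro equalityI subsetI)
          fix y assume "y \<in> \<phi> i ` ?C"
          then obtain x where x: "x \<in> realization_points K" "q x \<notin> U" "{v. x v \<noteq> 0} \<subseteq> e i" "y = \<phi> i x" by auto
          then show "y \<in> topspace ?S - ?V i" using q_wm[OF x(1,3) i] \<phi>_in[OF x(1) i] by simp
        next
          fix y assume y: "y \<in> topspace ?S - ?V i"
          then obtain x where x: "x \<in> realization_points K" "{v. x v \<noteq> 0} \<subseteq> e i" "\<phi> i x = y"
            using lift[OF i, of y] by blast
          then have "q x \<notin> U" using q_wm[OF x(1,2) i] y by auto
          then show "y \<in> \<phi> i ` ?C" using x by auto
        qed
        then have "closedin ?S (topspace ?S - ?V i)" using closed by simp
        then show ?thesis by (subst openin_closedin) auto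
      qed
      then show "openin ?W U" using U by (simp add: open_W)
    next
      assume "openin ?W U"
      then have V: "openin ?S (?V i)" if "i < ?n" for i using that by (simp add: open_W)
      \<comment> \<open>Each \<open>\<phi> i\<close> is continuous on the whole realization and
        takes the pole outside the interior of its triangle. So \<open>?P i\<close> imposes no
        condition there if \<open>None \<in> U\<close>, and contains no such point otherwise: the
        preimage of \<open>U\<close> under \<open>q\<close> is a finite intersection in the first
        case and a union in the second.\<close>
      let ?P = "\<lambda>i. {x \<in> topspace ?X. \<phi> i x \<in> ?V i}"
      have P: "openin ?X (?P i)" if "i < ?n" for i
        by (rule openin_continuous_map_preimage[OF \<phi>_cont[OF that] V[OF that]])
      have mem: "x \<in> ?P i \<longleftrightarrow> ?wm i (\<phi> i x) \<in> U" if "x \<in> realization_points K" "i < ?n" for x i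
        using \<phi>_in[OF that] that by simp
      have off: "?wm i (\<phi> i x) = None" if "x \<in> realization_points K" "i < ?n" "{v. x v \<noteq> 0} \<noteq> e i" for x i
        using \<phi>_pole[OF that(1,3,2)] by (simp add: wedge_map_def)
      have on: "?wm i (\<phi> i x) = q x" if "x \<in> realization_points K" "i < ?n" "{v. x v \<noteq> 0} = e i" for x i
        using q_wm[OF that(1) _ that(2)] that(3) by simp
      show "openin ?X {x \<in> topspace ?X. q x \<in> U}"
      proof (cases "None \<in> U")
        case True
        have "{x \<in> topspace ?X. q x \<in> U} = (\<Inter>i<?n. ?P i) \<inter> topspace ?X"
        proof (intro equalityI subsetI)
          fix x assume x: "x \<in> {x \<in> topspace ?X. q x \<in> U}"
          then have "x \<in> ?P i" if "i < ?n" for i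
            using mem[of x i] on[of x i] off[of x i] that True by (cases "{v. x v \<noteq> 0} = e i") auto
          then show "x \<in> (\<Inter>i<?n. ?P i) \<inter> topspace ?X" using x by blast
        next
          fix x assume x: "x \<in> (\<Inter>i<?n. ?P i) \<inter> topspace ?X"
          then have xK: "x \<in> realization_points K" by simp
          have "q x \<in> U"
          proof (cases "{v. x v \<noteq> 0} \<in> F")
            case True
            then obtain i where i: "i < ?n" "e i = {v. x v \<noteq> 0}" using e_surj by blast
            then have "x \<in> ?P i" using x by blast
            then show ?thesis using mem[OF xK i(1)] on[OF xK i(1)] i(2) by simp
          next
            case False
            then show ?thesis using \<open>None \<in> U\<close> by (simp add: q_def)
          qed
          then show "x \<in> {x \<in> topspace ?X. q x \<in> U}" using xK by simp
        qed
        then show ?thesis using openin_INT[of "{..<?n}" ?X ?P] P by simp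
      next
        case False
        have "{x \<in> topspace ?X. q x \<in> U} = (\<Union>i<?n. ?P i)"
        proof (intro equalityI subsetI)
          fix x assume x: "x \<in> {x \<in> topspace ?X. q x \<in> U}"
          then have xK: "x \<in> realization_points K" by simp
          have "{v. x v \<noteq> 0} \<in> F" using x False by (auto simp: q_def split: if_splits)
          then obtain i where i: "i < ?n" "e i = {v. x v \<noteq> 0}" using e_surj by blast
          then have "x \<in> ?P i" using mem[OF xK i(1)] on[OF xK i(1)] x by simp
          then show "x \<in> (\<Union>i<?n. ?P i)" using i(1) by blast
        next
          fix x assume "x \<in> (\<Union>i<?n. ?P i)"
          then obtain i where i: "i < ?n" "x \<in> ?P i" by blast
          then have xK: "x \<in> realization_points K" by simp
          have "?wm i (\<phi> i x) \<in> U" using mem[OF xK i(1)] i(2) by blast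
          then have "q x \<in> U" using on[OF xK i(1)] off[OF xK i(1)] False by metis
          then show "x \<in> {x \<in> topspace ?X. q x \<in> U}" using xK by simp
        qed
        moreover have "openin ?X (\<Union>i<?n. ?P i)" using P by (intro openin_Union) auto
        ultimately show ?thesis by simp
      qed
    qed
  qed
  obtain h a where h: "continuous_map (prod_topology (top_of_set {0..1::real}) (geometric_realization (K - F)))
                (geometric_realization (K - F)) h" "\<And>x. h (0, x) = x" "\<And>x. h (1, x) = a"
    using contr unfolding contractible_space_def homotopic_with_def by (auto simp: id_def)
  obtain H where H: "continuous_map (prod_topology (top_of_set {0..1::real}) ?X) ?X H"
    "\<And>x. x \<in> realization_points K \<Longrightarrow> H (0, x) = x"
    "\<And>t x. t \<in> {0..1} \<Longrightarrow> x \<in> realization_points (K - F) \<Longrightarrow> H (t, x) = h (t, x)"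
    using homotopy_extension[OF h(1) h(2)] by blast
  have rest: "x \<in> realization_points (K - F) \<longleftrightarrow> x \<in> realization_points K \<and> {v. x v \<noteq> 0} \<notin> F" for x
    by (auto simp: realization_points_def)
  show ?thesis
  proof (rule quotient_homotopy_equivalent[OF quot H(1)])
    show "H (0, x) = x" if "x \<in> topspace ?X" for x using that H(2) by simp
    show "realization_points (K - F) \<subseteq> topspace ?X" using rest_subset by simp
    show "H (t, x) \<in> realization_points (K - F)" if "t \<in> {0..1}" "x \<in> realization_points (K - F)" for t x
      using h(1) that H(3)[OF that] by (auto simp: continuous_map_def)
    show "H (1, x) = a" if "x \<in> realization_points (K - F)" for x
      using H(3)[OF _ that, of 1] h(3) by simp
    show "q x = q y" if "x \<in> realization_points (K - F)" "y \<in> realization_points (K - F)" for x y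
      using that by (simp add: q_def rest)
    fix x y assume xy: "x \<in> topspace ?X" "y \<in> topspace ?X" "q x = q y"
    show "x = y \<or> x \<in> realization_points (K - F) \<and> y \<in> realization_points (K - F)"
    proof (cases "{v. x v \<noteq> 0} \<in> F")
      case False
      then show ?thesis using xy q_rest[of x] q_rest[of y] by (simp add: rest)
    next
      case True
      then obtain i where i: "i < ?n" "{v. x v \<noteq> 0} = e i" using e_surj by metis
      have "{v. y v \<noteq> 0} \<in> F" using q_rest[of x] q_rest[of y] xy True by simp
      then obtain j where j: "j < ?n" "{v. y v \<noteq> 0} = e j" using e_surj by metis
      have eq: "Some (i, \<phi> i x) = Some (j, \<phi> j y)"
        unfolding q_interior[OF i(2,1), symmetric] q_interior[OF j(2,1), symmetric] by (rule xy(3))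
      have ij: "j = i" using eq by simp
      have \<phi>_eq: "\<phi> i x = \<phi> i y" using eq unfolding ij by simp
      have xK: "x \<in> realization_points K" "y \<in> realization_points K" using xy by auto
      have y: "{v. y v \<noteq> 0} = e i" using j ij by simp
      have "x (va i) = y (va i) \<and> x (vb i) = y (vb i) \<and> x (vc i) = y (vc i)"
        by (rule triangle_to_sphere_inj[OF pos[OF xK(1) i(2,1)] _ pos[OF xK(2) y i(1)] _ \<phi>_eq[unfolded \<phi>_def]])
          (use sum_abc[OF xK(1) _ i(1)] sum_abc[OF xK(2) _ i(1)] i(2) y in auto)
      then have "x v = y v" if "v \<in> e i" for v using that by (auto simp: abc[OF i(1)])
      moreover have "x v = y v" if "v \<notin> e i" for v
        using that unfolding i(2)[symmetric] using y[unfolded i(2)[symmetric]] by auto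
      ultimately have "x v = y v" for v by (cases "v \<in> e i")
      then show ?thesis by (intro disjI1 ext)
    qed
  qed
qed

end

section \<open>Cliques of order ideals\<close>

definition fill :: "nat set \<Rightarrow> nat set" where
  "fill \<mu> = insert (LEAST a. a \<notin> \<mu>) \<mu>"

text \<open>The argument needs no geometry of the diagrams. Intersections are the bases of stars,
  and unions are the ideals below which the other cliques lie. The numbering of the cells enters
  through \<open>remove_Max_ideal\<close> and \<open>fill_ideal\<close>, which keep the apexes of
  the collapses among the ideals.\<close>

locale ideal_family =
  fixes \<I> :: "nat set set" and n :: nat
  assumes finite_ideal: "\<And>A. A \<in> \<I> \<Longrightarrow> finite A"
    and empty_ideal: "{} \<in> \<I>"
    and Int_ideal: "\<And>A B. A \<in> \<I> \<Longrightarrow> B \<in> \<I> \<Longrightarrow> A \<inter> B \<in> \<I>"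
    and Un_ideal: "\<And>A B. A \<in> \<I> \<Longrightarrow> B \<in> \<I> \<Longrightarrow> A \<union> B \<in> \<I>"
    and remove_Max_ideal: "\<And>A. A \<in> \<I> \<Longrightarrow> A \<noteq> {} \<Longrightarrow> A - {Max A} \<in> \<I>"
    and fill_ideal: "\<And>A. A \<in> \<I> \<Longrightarrow> fill A \<in> \<I>"
    and finite_level: "finite {A \<in> \<I>. card A = n}"
begin

definition level :: "nat set set" where
  "level = {A \<in> \<I>. card A = n}"

definition adjacent :: "nat set \<Rightarrow> nat set \<Rightarrow> bool" where
  "adjacent A B \<longleftrightarrow> A \<noteq> B \<and> Suc (card (A \<inter> B)) = n"

definition cliques :: "nat set set set" where
  "cliques = {\<sigma>. \<sigma> \<subseteq> level \<and> \<sigma> \<noteq> {} \<and> (\<forall>A\<in>\<sigma>. \<forall>B\<in>\<sigma>. A \<noteq> B \<longrightarrow> adjacent A B)}"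

definition star_triangle :: "nat set set \<Rightarrow> bool" where
  "star_triangle \<tau> \<longleftrightarrow> \<tau> \<subseteq> level \<and> card \<tau> = 3 \<and> Suc (card (\<Inter>\<tau>)) = n"

definition redundant :: "nat set set set" where
  "redundant = {\<tau>. star_triangle \<tau> \<and> fill (\<Inter>\<tau>) \<notin> \<tau>}"

definition critical :: "nat set set set" where
  "critical = {\<tau>. star_triangle \<tau> \<and> fill (\<Inter>\<tau>) \<in> \<tau> \<and> Max (\<Union>\<tau>) \<in> \<Inter>\<tau>}"

section \<open>Intersections, unions and cliques within a level\<close>

lemma level_finite: "A \<in> level \<Longrightarrow> finite A"
  and level_card: "A \<in> level \<Longrightarrow> card A = n"
  and level_ideal: "A \<in> level \<Longrightarrow> A \<in> \<I>"
  by (auto simp: level_def finite_ideal)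

lemma levelI: "A \<in> \<I> \<Longrightarrow> card A = n \<Longrightarrow> A \<in> level"
  by (simp add: level_def)

lemma adjacent_sym: "adjacent A B \<Longrightarrow> adjacent B A"
  by (auto simp: adjacent_def Int_commute)

lemma level_subset_eq: "A \<in> level \<Longrightarrow> B \<in> level \<Longrightarrow> A \<subseteq> B \<Longrightarrow> A = B"
  using card_subset_eq[of B A] level_finite level_card by simp

lemma level_Int_eq:
  assumes "A \<in> level" "B \<in> level" "A \<noteq> B" and \<mu>: "\<mu> \<subseteq> A" "\<mu> \<subseteq> B" "Suc (card \<mu>) = n"
  shows "A \<inter> B = \<mu>"
proof -
  have "A \<inter> B \<subset> A" using assms level_subset_eq[of A B] by blast
  then have "card (A \<inter> B) < n"
    using psubset_card_mono[OF level_finite[OF assms(1)]] level_card[OF assms(1)] by metis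
  then have "card (A \<inter> B) \<le> card \<mu>" using \<mu>(3) by simp
  then have "\<mu> = A \<inter> B"
    using \<mu> level_finite[OF assms(1)] by (intro card_seteq) auto
  then show ?thesis by simp
qed

lemma adjacent_subset:
  assumes "A \<in> level" "B \<in> level" "A \<noteq> B" "\<mu> \<subseteq> A" "\<mu> \<subseteq> B" "Suc (card \<mu>) = n"
  shows "adjacent A B"
  using level_Int_eq[OF assms] assms(3,6) by (simp add: adjacent_def)

lemma adjacent_in_superset:
  assumes AB: "A \<in> level" "B \<in> level" "A \<noteq> B" and \<nu>: "A \<subseteq> \<nu>" "B \<subseteq> \<nu>" "card \<nu> = Suc n" "finite \<nu>"
  shows "adjacent A B" "A \<union> B = \<nu>"
proof -
  note fin = level_finite[OF AB(1)] level_finite[OF AB(2)]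
  have "A \<subset> A \<union> B" using AB level_subset_eq[of B A] by blast
  then have "n < card (A \<union> B)"
    using psubset_card_mono[of "A \<union> B" A] fin level_card[OF AB(1)] by simp
  moreover have "card (A \<union> B) \<le> Suc n" using card_mono[of \<nu> "A \<union> B"] \<nu> by simp
  ultimately have c: "card (A \<union> B) = Suc n" by simp
  show "A \<union> B = \<nu>" by (rule card_subset_eq) (use \<nu> c in auto)
  show "adjacent A B"
    using card_Un_Int[OF fin] level_card[OF AB(1)] level_card[OF AB(2)] c AB(3)
    unfolding adjacent_def by linarith
qed

text \<open>If \<open>E\<close> has a cell \<open>x\<close> outside \<open>A \<union> B\<close>,
  then by cardinality \<open>E\<close> meets \<open>A\<close> and \<open>B\<close> in the same set
  \<open>E - {x}\<close>, which must then be \<open>A \<inter> B\<close>.\<close>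

lemma clique_dichotomy:
  assumes lev: "A \<in> level" "B \<in> level" "E \<in> level"
    and adj: "adjacent A B" "adjacent E A" "adjacent E B"
  shows "A \<inter> B \<subseteq> E \<or> E \<subseteq> A \<union> B"
proof (rule disjCI)
  assume "\<not> E \<subseteq> A \<union> B"
  then obtain x where x: "x \<in> E" "x \<notin> A" "x \<notin> B" by blast
  note fin = level_finite[OF lev(3)]
  have "E \<inter> X = E - {x}" if "adjacent E X" "x \<notin> X" for X
  proof (rule card_subset_eq)
    show "card (E \<inter> X) = card (E - {x})"
      using that(1) level_card[OF lev(3)] fin x(1) by (auto simp: adjacent_def)
  qed (use fin that(2) in auto)
  then have "E - {x} \<subseteq> A" "E - {x} \<subseteq> B" using adj x by blast+
  moreover have "Suc (card (E - {x})) = n"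
    using level_card[OF lev(3)] fin x(1) by (metis card_Suc_Diff1)
  ultimately have "A \<inter> B = E - {x}"
    using level_Int_eq[OF lev(1,2)] adj(1) by (simp add: adjacent_def)
  then show "A \<inter> B \<subseteq> E" by blast
qed

lemma star_triangle_Int:
  assumes "star_triangle \<tau>" "A \<in> \<tau>" "B \<in> \<tau>" "A \<noteq> B"
  shows "A \<inter> B = \<Inter>\<tau>"
  by (rule level_Int_eq) (use assms in \<open>auto simp: star_triangle_def\<close>)

lemma star_triangle_elements:
  assumes "star_triangle \<tau>"
  obtains A B E where "\<tau> = {A, B, E}" "A \<noteq> B" "A \<noteq> E" "B \<noteq> E" "A \<in> level" "B \<in> level" "E \<in> level"
    "Suc (card (\<Inter>\<tau>)) = n"
proof -
  obtain A B E where "\<tau> = {A, B, E}" "A \<noteq> B" "A \<noteq> E" "B \<noteq> E"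
    using assms unfolding star_triangle_def card_3_iff by blast
  moreover have "\<tau> \<subseteq> level" "Suc (card (\<Inter>\<tau>)) = n" using assms by (auto simp: star_triangle_def)
  ultimately show ?thesis using that[of A B E] by simp
qed

lemma star_triangleI:
  assumes "A \<in> level" "B \<in> level" "E \<in> level" "A \<noteq> B" "A \<noteq> E" "B \<noteq> E"
    and \<mu>: "\<mu> \<subseteq> A" "\<mu> \<subseteq> B" "\<mu> \<subseteq> E" "Suc (card \<mu>) = n"
  shows "star_triangle {A, B, E}" "\<Inter>{A, B, E} = \<mu>"
proof -
  show I: "\<Inter>{A, B, E} = \<mu>"
    using level_Int_eq[OF assms(1,2,4) \<mu>(1,2,4)] \<mu>(3) by auto
  show "star_triangle {A, B, E}"
    unfolding star_triangle_def I using assms by simp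
qed

lemma star_triangle_Inter_ideal:
  assumes "star_triangle \<tau>"
  shows "\<Inter>\<tau> \<in> \<I>" "finite (\<Inter>\<tau>)"
proof -
  obtain A B E where "\<tau> = {A, B, E}" "A \<in> level" "B \<in> level" "E \<in> level"
    using star_triangle_elements[OF assms] by metis
  then show "\<Inter>\<tau> \<in> \<I>" using level_ideal Int_ideal by simp
  then show "finite (\<Inter>\<tau>)" by (rule finite_ideal)
qed

text \<open>Otherwise the dichotomy puts \<open>B\<close> below the union of any two members. But
  \<open>X \<union> Y\<close> and \<open>X \<union> Z\<close> meet in
  \<open>X \<union> (Y \<inter> Z) = X\<close>, so \<open>B = X\<close>. Hence a clique that
  contains a star triangle lies entirely in the star of its intersection.\<close>

lemma star_triangle_subset_neighbour:
  assumes \<tau>: "star_triangle \<tau>" and B: "B \<in> level" "\<And>A. A \<in> \<tau> \<Longrightarrow> A \<noteq> B \<Longrightarrow> adjacent A B"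
  shows "\<Inter>\<tau> \<subseteq> B"
proof (rule ccontr)
  assume neg: "\<not> \<Inter>\<tau> \<subseteq> B"
  then have "B \<notin> \<tau>" by blast
  obtain X Y Z where xyz: "\<tau> = {X, Y, Z}" "X \<noteq> Y" "X \<noteq> Z" "Y \<noteq> Z" "X \<in> level" "Y \<in> level" "Z \<in> level"
    "Suc (card (\<Inter>\<tau>)) = n"
    using star_triangle_elements[OF \<tau>] .
  have sub: "B \<subseteq> A \<union> A'" if A: "A \<in> \<tau>" "A' \<in> \<tau>" "A \<noteq> A'" for A A'
  proof -
    have I: "A \<inter> A' = \<Inter>\<tau>" using star_triangle_Int[OF \<tau> A] .
    have "adjacent A A'" using I A(3) xyz(8) by (simp add: adjacent_def)
    moreover have "A \<in> level" "A' \<in> level" using A \<tau> by (auto simp: star_triangle_def)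
    moreover have "adjacent B A" "adjacent B A'"
      using B(2) A \<open>B \<notin> \<tau>\<close> adjacent_sym by blast+
    ultimately show ?thesis using clique_dichotomy[of A A' B] I neg B(1) by blast
  qed
  have "Y \<inter> Z \<subseteq> X" using star_triangle_Int[OF \<tau>, of Y Z] xyz by blast
  moreover have "B \<subseteq> X \<union> Y" "B \<subseteq> X \<union> Z" using sub xyz by auto
  ultimately have "B \<subseteq> X" by blast
  then have "B = X" using level_subset_eq[OF B(1)] xyz by simp
  then show False using \<open>B \<notin> \<tau>\<close> xyz by simp
qed

text \<open>Two members already fill \<open>\<nu>\<close>, so the third is contained in their union.
  It meets each of them in \<open>\<Inter>\<tau>\<close> only and would have to equal that smaller
  set.\<close>

lemma star_triangle_not_below:
  assumes "star_triangle \<tau>" "\<And>A. A \<in> \<tau> \<Longrightarrow> A \<subseteq> \<nu>" "card \<nu> = Suc n" "finite \<nu>"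
  shows False
proof -
  obtain X Y Z where xyz: "\<tau> = {X, Y, Z}" "X \<noteq> Y" "X \<noteq> Z" "Y \<noteq> Z" "X \<in> level" "Y \<in> level" "Z \<in> level"
    "Suc (card (\<Inter>\<tau>)) = n"
    using star_triangle_elements[OF assms(1)] .
  have "X \<union> Y = \<nu>"
    using adjacent_in_superset(2)[of X Y \<nu>] xyz assms(2-4) by simp
  then have "Z \<subseteq> X \<union> Y" using assms(2)[of Z] xyz by simp
  moreover have "Z \<inter> X = \<Inter>\<tau>" "Z \<inter> Y = \<Inter>\<tau>"
    by (rule star_triangle_Int[OF assms(1)]; use xyz(1-4) in simp)+
  ultimately have "Z = \<Inter>\<tau>"
    by (metis Int_Un_distrib Int_absorb2 Un_absorb)
  then show False using xyz level_card[of Z] by simp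
qed

section \<open>Removal of the redundant star triangles\<close>

lemma fill_not_mem:
  fixes \<mu> :: "nat set" assumes "finite \<mu>"
  shows "(LEAST a. a \<notin> \<mu>) \<notin> \<mu>"
proof -
  obtain a where "a \<notin> \<mu>" using ex_new_if_finite[OF infinite_UNIV_nat assms] by blast
  then show ?thesis by (rule LeastI[where P = "\<lambda>a. a \<notin> \<mu>"])
qed

lemma fill_level: "\<mu> \<in> \<I> \<Longrightarrow> Suc (card \<mu>) = n \<Longrightarrow> fill \<mu> \<in> level"
  using fill_ideal[of \<mu>] finite_ideal[of \<mu>] fill_not_mem[of \<mu>] by (auto simp: fill_def level_def)

lemma fill_superset: "\<mu> \<subseteq> fill \<mu>"
  by (auto simp: fill_def)

lemma cliques_adjacent: "\<sigma> \<in> cliques \<Longrightarrow> A \<in> \<sigma> \<Longrightarrow> B \<in> \<sigma> \<Longrightarrow> A \<noteq> B \<Longrightarrow> adjacent A B"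
  and cliques_level: "\<sigma> \<in> cliques \<Longrightarrow> A \<in> \<sigma> \<Longrightarrow> A \<in> level"
  by (auto simp: cliques_def)

lemma finite_vertices: "finite level"
  using finite_level by (simp add: level_def)

lemma finite_cliques: "finite cliques"
  by (rule finite_subset[of _ "Pow level"]) (auto simp: cliques_def finite_vertices)

lemma complex_cliques: "abstract_complex cliques"
  unfolding abstract_complex_def
proof (intro conjI ballI allI impI)
  fix \<sigma> assume "\<sigma> \<in> cliques"
  then show "finite \<sigma>" "\<sigma> \<noteq> {}"
    using finite_subset[OF _ finite_vertices] by (auto simp: cliques_def)
  show "\<tau> \<in> cliques" if "\<tau> \<subseteq> \<sigma> \<and> \<tau> \<noteq> {}" for \<tau>
    using that \<open>\<sigma> \<in> cliques\<close> unfolding cliques_def mem_Collect_eq by (meson subset_eq)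
qed

lemma insert_clique:
  assumes "\<sigma> \<in> cliques" "B \<in> level" "\<And>A. A \<in> \<sigma> \<Longrightarrow> A \<noteq> B \<Longrightarrow> adjacent A B"
  shows "insert B \<sigma> \<in> cliques"
  using assms adjacent_sym unfolding cliques_def by auto

lemma insert_clique_above:
  assumes "\<sigma> \<in> cliques" "B \<in> level" "\<And>A. A \<in> insert B \<sigma> \<Longrightarrow> \<mu> \<subseteq> A" "Suc (card \<mu>) = n"
  shows "insert B \<sigma> \<in> cliques"
proof (rule insert_clique[OF assms(1,2)])
  fix A assume "A \<in> \<sigma>" "A \<noteq> B"
  then show "adjacent A B"
    using adjacent_subset[of A B \<mu>] cliques_level[OF assms(1)] assms(2-4) by blast
qed

lemma clique_above_star_triangle:
  assumes "\<sigma> \<in> cliques" "star_triangle \<tau>" "\<tau> \<subseteq> \<sigma>" "B \<in> \<sigma>"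
  shows "\<Inter>\<tau> \<subseteq> B"
  using star_triangle_subset_neighbour[OF assms(2)] cliques_level[OF assms(1)]
    cliques_adjacent[OF assms(1)] assms(3,4) by blast

lemma Inter_eq_of_above:
  assumes "star_triangle \<tau>" "\<And>A. A \<in> \<tau> \<Longrightarrow> \<mu> \<subseteq> A" "Suc (card \<mu>) = n"
  shows "\<Inter>\<tau> = \<mu>"
proof -
  obtain A B E where ABE: "\<tau> = {A, B, E}" "A \<noteq> B" "A \<in> level" "B \<in> level"
    using star_triangle_elements[OF assms(1)] by metis
  have "A \<inter> B = \<Inter>\<tau>" using star_triangle_Int[OF assms(1)] ABE by simp
  moreover have "A \<inter> B = \<mu>" using level_Int_eq[of A B \<mu>] ABE assms(2,3) by simp
  ultimately show ?thesis by simp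
qed

definition thin_cliques :: "nat set set set" where
  "thin_cliques = {\<sigma> \<in> cliques. \<forall>\<tau>\<in>redundant. \<not> \<tau> \<subseteq> \<sigma>}"

lemma star_triangle_finite: "finite {\<tau>. star_triangle \<tau>}"
  by (rule finite_subset[of _ "Pow level"]) (auto simp: star_triangle_def finite_vertices)

lemma star_triangle_nonempty: "star_triangle \<tau> \<Longrightarrow> finite \<tau> \<and> \<tau> \<noteq> {}"
  unfolding star_triangle_def by (metis card.empty card.infinite zero_neq_numeral)

text \<open>A clique through a redundant triangle lies in the star of its intersection, so the least
  member \<open>fill (\<Inter>\<tau>)\<close> of that star can be added to it. A redundant triangle
  inside the enlarged clique has the same intersection and therefore avoids the added vertex, so the
  removals do not interfere.\<close>

lemma collapses_thin: "collapses cliques thin_cliques"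
  unfolding thin_cliques_def
proof (rule collapses_stars[where w = "\<lambda>\<tau>. fill (\<Inter>\<tau>)"])
  show "finite redundant"
    by (rule finite_subset[OF _ star_triangle_finite]) (auto simp: redundant_def)
  show "finite \<tau> \<and> \<tau> \<noteq> {} \<and> fill (\<Inter>\<tau>) \<notin> \<tau>" if "\<tau> \<in> redundant" for \<tau>
    using that star_triangle_nonempty by (simp add: redundant_def)
  fix \<tau> \<sigma> assume \<tau>: "\<tau> \<in> redundant" and \<sigma>: "\<sigma> \<in> cliques" "\<tau> \<subseteq> \<sigma>"
  have st: "star_triangle \<tau>" using \<tau> by (simp add: redundant_def)
  have card: "Suc (card (\<Inter>\<tau>)) = n" using st by (simp add: star_triangle_def)
  have above: "\<Inter>\<tau> \<subseteq> A" if "A \<in> insert (fill (\<Inter>\<tau>)) \<sigma>" for A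
    using that clique_above_star_triangle[OF \<sigma>(1) st \<sigma>(2)] fill_superset by blast
  show "insert (fill (\<Inter>\<tau>)) \<sigma> \<in> cliques"
    by (rule insert_clique_above[OF \<sigma>(1) fill_level[OF star_triangle_Inter_ideal(1)[OF st] card] above card])
  show "\<tau>' \<subseteq> \<sigma>" if \<tau>': "\<tau>' \<in> redundant" "\<tau>' \<subseteq> insert (fill (\<Inter>\<tau>)) \<sigma>" for \<tau>'
  proof -
    have "\<Inter>\<tau>' = \<Inter>\<tau>"
    proof (rule Inter_eq_of_above[OF _ _ card])
      show "star_triangle \<tau>'" using \<tau>'(1) by (simp add: redundant_def)
      show "\<Inter>\<tau> \<subseteq> A" if "A \<in> \<tau>'" for A using above that \<tau>'(2) by blast
    qed
    then have "fill (\<Inter>\<tau>) \<notin> \<tau>'" using \<tau>'(1) by (simp add: redundant_def)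
    then show ?thesis using \<tau>'(2) by blast
  qed
qed

lemma star_triangle_clique: "star_triangle \<tau> \<Longrightarrow> \<tau> \<in> cliques"
  using star_triangle_nonempty[of \<tau>] star_triangle_Int[of \<tau>]
  by (auto simp: cliques_def star_triangle_def adjacent_def)

text \<open>Maximality is the point: if a simplex contained a fourth vertex \<open>B\<close>, then
  \<open>B\<close> and the two members of the triangle other than
  \<open>fill (\<Inter>\<tau>)\<close> would form a star triangle over the same ideal that avoids
  \<open>fill (\<Inter>\<tau>)\<close>, hence a redundant one.\<close>

lemma triangle_facets_thin: "triangle_facets thin_cliques critical"
proof
  show "abstract_complex thin_cliques"
    using collapses_thin complex_cliques finite_cliques by (simp add: collapses_def)
  show "finite critical"
    by (rule finite_subset[OF _ star_triangle_finite]) (auto simp: critical_def)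
  show "card \<tau> = 3" if "\<tau> \<in> critical" for \<tau>
    using that by (simp add: critical_def star_triangle_def)
  show "critical \<subseteq> thin_cliques"
  proof
    fix \<tau> assume \<tau>: "\<tau> \<in> critical"
    then have st: "star_triangle \<tau>" by (simp add: critical_def)
    have "\<rho> = \<tau>" if "\<rho> \<in> redundant" "\<rho> \<subseteq> \<tau>" for \<rho>
      by (rule card_subset_eq) (use that st star_triangle_nonempty[OF st] in \<open>auto simp: redundant_def star_triangle_def\<close>)
    moreover have "\<tau> \<notin> redundant" using \<tau> by (simp add: critical_def redundant_def)
    ultimately show "\<tau> \<in> thin_cliques"
      using star_triangle_clique[OF st] by (auto simp: thin_cliques_def)
  qed
  fix \<tau> \<sigma> assume \<tau>: "\<tau> \<in> critical" and \<sigma>: "\<sigma> \<in> thin_cliques" "\<tau> \<subseteq> \<sigma>"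
  have st: "star_triangle \<tau>" and fill: "fill (\<Inter>\<tau>) \<in> \<tau>" using \<tau> by (auto simp: critical_def)
  have \<sigma>K: "\<sigma> \<in> cliques" using \<sigma> by (simp add: thin_cliques_def)
  have "B \<in> \<tau>" if B: "B \<in> \<sigma>" for B
  proof (rule ccontr)
    assume "B \<notin> \<tau>"
    have card: "Suc (card (\<Inter>\<tau>)) = n" and lev: "\<tau> \<subseteq> level"
      using st by (auto simp: star_triangle_def)
    have "card (\<tau> - {fill (\<Inter>\<tau>)}) = 2"
      using st fill star_triangle_nonempty[OF st] by (simp add: star_triangle_def)
    then obtain P Q where "\<tau> - {fill (\<Inter>\<tau>)} = {P, Q}" and ne: "P \<noteq> Q"
      unfolding card_2_iff by blast
    then have PQ: "P \<in> \<tau>" "Q \<in> \<tau>" "P \<noteq> fill (\<Inter>\<tau>)" "Q \<noteq> fill (\<Inter>\<tau>)"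
      by (blast dest: equalityD2)+
    have Bl: "B \<in> level" "\<Inter>\<tau> \<subseteq> B"
      using cliques_level[OF \<sigma>K B] clique_above_star_triangle[OF \<sigma>K st \<sigma>(2) B] by auto
    have "P \<in> level" "Q \<in> level" "P \<noteq> B" "Q \<noteq> B" "\<Inter>\<tau> \<subseteq> P" "\<Inter>\<tau> \<subseteq> Q"
      using PQ lev \<open>B \<notin> \<tau>\<close> by auto
    then have "star_triangle {P, Q, B}" "\<Inter>{P, Q, B} = \<Inter>\<tau>"
      using star_triangleI[of P Q B "\<Inter>\<tau>"] Bl ne card by simp_all
    then have "{P, Q, B} \<in> redundant"
      using PQ fill \<open>B \<notin> \<tau>\<close> by (auto simp: redundant_def)
    moreover have "{P, Q, B} \<subseteq> \<sigma>" using PQ \<sigma>(2) B by blast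
    ultimately show False using \<sigma>(1) by (auto simp: thin_cliques_def)
  qed
  then show "\<sigma> = \<tau>" using \<sigma>(2) by blast
qed

end

section \<open>Collapsing to a vertex\<close>

lemma sum_swap_less:
  fixes A :: "nat set"
  assumes "finite A" "c \<in> A" "a \<notin> A"
  shows "\<Sum>(insert a (A - {c})) < \<Sum>A \<longleftrightarrow> a < c" "\<Sum>(insert a (A - {c})) = \<Sum>A \<longleftrightarrow> a = c"
proof -
  have "\<Sum>A = c + \<Sum>(A - {c})" using assms by (simp add: sum.remove)
  moreover have "\<Sum>(insert a (A - {c})) = a + \<Sum>(A - {c})" using assms by simp
  ultimately show "\<Sum>(insert a (A - {c})) < \<Sum>A \<longleftrightarrow> a < c" "\<Sum>(insert a (A - {c})) = \<Sum>A \<longleftrightarrow> a = c"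
    by simp_all
qed

context ideal_family
begin

lemma adjacent_swap:
  assumes "A \<in> level" "B \<in> level" "adjacent B A"
  obtains a c where "c \<in> A" "a \<notin> A" "B = insert a (A - {c})"
proof -
  have card: "Suc (card (A \<inter> B)) = n" "Suc (card (B \<inter> A)) = n"
    using assms(3) by (simp_all add: adjacent_def Int_commute)
  have "card (A - B) = n - card (A \<inter> B)" "card (B - A) = n - card (B \<inter> A)"
    using card_Diff_subset_Int[of A B] card_Diff_subset_Int[of B A] level_finite[OF assms(1)]
      level_card[OF assms(1)] level_card[OF assms(2)] by simp_all
  then have "card (A - B) = 1" "card (B - A) = 1" using card by linarith+
  then obtain a c where ac: "A - B = {c}" "B - A = {a}"
    by (elim card_1_singletonE)
  show ?thesis
  proof
    show "c \<in> A" "a \<notin> A" "B = insert a (A - {c})" using ac by blast+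
  qed
qed

definition collapsible_part :: "nat set set \<Rightarrow> nat set set set" where
  "collapsible_part W = {\<sigma> \<in> thin_cliques - critical. \<sigma> \<subseteq> W}"

text \<open>Critical triangles are facets of \<open>thin_cliques\<close>, so deleting them amounts
  to forbidding them as subsets. Both kinds of forbidden triangle can then be treated alike.\<close>

lemma collapsible_part_iff:
  "\<sigma> \<in> collapsible_part W \<longleftrightarrow>
     \<sigma> \<in> cliques \<and> \<sigma> \<subseteq> W \<and> (\<forall>\<tau>\<in>redundant \<union> critical. \<not> \<tau> \<subseteq> \<sigma>)"
proof -
  have "\<sigma> \<in> thin_cliques - critical \<longleftrightarrow> \<sigma> \<in> thin_cliques \<and> (\<forall>\<tau>\<in>critical. \<not> \<tau> \<subseteq> \<sigma>)"
    using triangle_facets.facet_maximal[OF triangle_facets_thin, of _ \<sigma>] by blast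
  then show ?thesis unfolding collapsible_part_def thin_cliques_def by blast
qed

lemma redundant_or_critical_star: "\<tau> \<in> redundant \<union> critical \<Longrightarrow> star_triangle \<tau>"
  by (auto simp: redundant_def critical_def)

text \<open>Each edge from \<open>l\<close> down to \<open>B\<close> that keeps \<open>Max l\<close> is pushed towards the neighbour with
  \<open>Max l\<close> removed; then the edges that lose \<open>Max l\<close> are pushed towards the lowest such
  neighbour, and finally \<open>l\<close> itself is dominated by it.\<close>

lemma collapse_vertex:
  assumes W: "W \<subseteq> level" and l: "l \<in> W" "l \<noteq> {..<n}"
    and below: "\<And>B. B \<in> W \<Longrightarrow> adjacent B l \<Longrightarrow> \<Sum>B < \<Sum>l"
    and closed: "\<And>A. A \<in> level \<Longrightarrow> \<Sum>A < \<Sum>l \<Longrightarrow> A \<in> W"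
  shows "collapses (collapsible_part W) (collapsible_part (W - {l}))"
proof -
  have lev: "l \<in> level" using W l by blast
  have fin: "finite l" using level_finite[OF lev] .
  have "l \<noteq> {}" using l(2) level_card[OF lev] by auto
  define M where "M = Max l"
  have M: "M \<in> l" "\<And>x. x \<in> l \<Longrightarrow> x \<le> M" using fin \<open>l \<noteq> {}\<close> by (auto simp: M_def)
  define \<mu> where "\<mu> = l - {M}"
  have \<mu>: "\<mu> \<in> \<I>" "finite \<mu>" "Suc (card \<mu>) = n" "\<mu> \<subseteq> l" "M \<notin> \<mu>"
    using remove_Max_ideal[OF level_ideal[OF lev] \<open>l \<noteq> {}\<close>] fin level_card[OF lev]
      card_Suc_Diff1[OF fin M(1)]
    unfolding \<mu>_def M_def by auto
  have down: "\<exists>a c. c \<in> l \<and> a \<notin> l \<and> B = insert a (l - {c}) \<and> a < c" if B: "B \<in> W" "adjacent B l" for B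
  proof -
    obtain a c where ac: "c \<in> l" "a \<notin> l" "B = insert a (l - {c})"
      using adjacent_swap[OF lev _ B(2)] W B(1) by blast
    then show ?thesis using below[OF B] sum_swap_less(1)[OF fin ac(1,2)] by blast
  qed
  define a0 where "a0 = (LEAST a. a \<notin> \<mu>)"
  define p where "p = fill \<mu>"
  have p_eq: "p = insert a0 \<mu>" by (simp add: p_def a0_def fill_def)
  have a0: "a0 \<notin> \<mu>" unfolding a0_def by (rule fill_not_mem[OF \<mu>(2)])
  have a0_min: "x \<in> \<mu>" if "x < a0" for x
    using not_less_Least[of x "\<lambda>a. a \<notin> \<mu>"] that unfolding a0_def by blast
  \<comment> \<open>Otherwise \<open>\<mu>\<close> contains every cell below \<open>M\<close>, and
    \<open>l\<close> is an initial segment, hence the root \<open>{..<n}\<close>.\<close>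
  have a0M: "a0 < M"
  proof (rule ccontr)
    assume "\<not> a0 < M"
    then have "x \<in> l" if "x \<le> M" for x
      using that a0_min[of x] M(1) \<mu>(4) by (cases "x = M") auto
    then have "l = {..<Suc M}" using M(2) by (auto simp: less_Suc_eq_le)
    then show False using l(2) level_card[OF lev] by auto
  qed
  have a0l: "a0 \<notin> l" using a0 a0M by (auto simp: \<mu>_def)
  have p: "p \<in> level" "p \<noteq> l" "M \<notin> p" "\<mu> \<subseteq> p"
    using fill_level[OF \<mu>(1,3)] p_eq a0l a0M \<mu>(5) by (auto simp: p_def)
  have "\<Sum>p < \<Sum>l" using sum_swap_less(1)[OF fin M(1) a0l] a0M by (simp add: p_eq \<mu>_def)
  then have pW: "p \<in> W" using closed p(1) by blast
  have lp: "adjacent l p" by (rule adjacent_subset[OF lev p(1) _ \<mu>(4) p(4) \<mu>(3)]) (use p(2) in simp)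

  define S1 where "S1 = {{l, B} |B. B \<in> W \<and> adjacent B l \<and> M \<in> B}"
  define S2 where "S2 = {{l, B} |B. B \<in> W \<and> adjacent B l \<and> M \<notin> B \<and> B \<noteq> p}"
  define L0 where "L0 = collapsible_part W"
  define L1 where "L1 = {\<sigma> \<in> L0. \<forall>\<tau>\<in>S1. \<not> \<tau> \<subseteq> \<sigma>}"
  define L2 where "L2 = {\<sigma> \<in> L1. \<forall>\<tau>\<in>S2. \<not> \<tau> \<subseteq> \<sigma>}"
  have finW: "finite W" using finite_subset[OF W finite_vertices] .
  have clique: "\<sigma> \<in> cliques" "\<sigma> \<subseteq> W" if "\<sigma> \<in> L0" for \<sigma>
    using that by (simp_all add: L0_def collapsible_part_iff)
  have nbr: "B \<in> W" "adjacent B l" if "\<sigma> \<in> L0" "l \<in> \<sigma>" "B \<in> \<sigma>" "B \<noteq> l" for B \<sigma>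
    using clique[OF that(1)] cliques_adjacent that by blast+

  have "collapses L0 L1"
    unfolding L1_def
  \<comment> \<open>For an edge \<open>{l, B}\<close> the apex is \<open>l \<union> B\<close>
    without its largest cell. It is an ideal, is adjacent to every other vertex below
    \<open>l \<union> B\<close>, and has smaller cell sum than \<open>l\<close>, so it still belongs
    to \<open>W\<close>.\<close>
  proof (rule collapses_stars[where w = "\<lambda>\<tau>. \<Union>\<tau> - {M}"])
    have "S1 \<subseteq> (\<lambda>B. {l, B}) ` W" by (auto simp: S1_def)
    then show "finite S1" using finW finite_subset by blast
    show "finite \<tau> \<and> \<tau> \<noteq> {} \<and> \<Union>\<tau> - {M} \<notin> \<tau>" if "\<tau> \<in> S1" for \<tau>
      using that M(1) by (auto simp: S1_def)
    fix \<tau> \<sigma> assume \<tau>: "\<tau> \<in> S1" and \<sigma>: "\<sigma> \<in> L0" "\<tau> \<subseteq> \<sigma>"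
    obtain B where B: "\<tau> = {l, B}" "B \<in> W" "adjacent B l" "M \<in> B" using \<tau> by (auto simp: S1_def)
    have Bl: "B \<in> level" "B \<noteq> l" using B W by (auto simp: adjacent_def)
    define \<nu> where "\<nu> = l \<union> B"
    define w where "w = \<Union>\<tau> - {M}"
    have w: "w = \<nu> - {M}" by (simp add: w_def \<nu>_def B(1))
    obtain a c where ac: "c \<in> l" "a \<notin> l" "B = insert a (l - {c})" "a < c" using down[OF B(2,3)] by blast
    have \<nu>_eq: "\<nu> = insert a l" using ac by (auto simp: \<nu>_def)
    have cM: "c \<le> M" using M(2) ac(1) .
    have aM: "a < M" using cM ac(4) by simp
    have \<nu>: "\<nu> \<in> \<I>" "finite \<nu>" "card \<nu> = Suc n" "M \<in> \<nu>"
      using Un_ideal[OF level_ideal[OF lev] level_ideal[OF Bl(1)]] fin ac(2) level_card[OF lev] M(1)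
      by (auto simp: \<nu>_def[symmetric]) (simp_all add: \<nu>_eq)
    have "Max \<nu> = M" using \<nu>(2,4) M(2) aM by (intro Max_eqI) (auto simp: \<nu>_eq)
    moreover have "\<nu> \<noteq> {}" using \<nu>(4) by blast
    ultimately have "w \<in> \<I>" using remove_Max_ideal[OF \<nu>(1)] by (simp add: w)
    moreover have "card w = n" using \<nu> by (simp add: w)
    ultimately have w_lev: "w \<in> level" by (rule levelI)
    have "w = insert a (l - {M})" using ac(2) aM by (auto simp: w \<nu>_eq)
    then have "\<Sum>w < \<Sum>l" using sum_swap_less(1)[OF fin M(1) ac(2)] aM by simp
    then have wW: "w \<in> W" using closed w_lev by blast
    have Mw: "M \<notin> w" by (simp add: w)
    have sub: "E \<subseteq> \<nu>" if E: "E \<in> \<sigma>" for E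
    proof (cases "E = l \<or> E = B")
      case True
      then show ?thesis by (auto simp: \<nu>_def)
    next
      case False
      have "B \<in> \<sigma>" "l \<in> \<sigma>" using \<sigma>(2) B(1) by auto
      note EW = nbr[OF \<sigma>(1) \<open>l \<in> \<sigma>\<close> E]
      have E_lev: "E \<in> level" using EW W False by blast
      \<comment> \<open>Such an \<open>E\<close> would span a star triangle with \<open>l\<close>
        and \<open>B\<close>. All neighbours of \<open>l\<close> in \<open>W\<close> arise by
        exchanging a cell for a smaller one, so \<open>M\<close> is the largest cell of the union,
        and it lies in the intersection: the triangle would be redundant or critical.\<close>
      have "\<not> l \<inter> B \<subseteq> E"
      proof
        assume LB: "l \<inter> B \<subseteq> E"
        have crd: "Suc (card (l \<inter> B)) = n" using B(3) by (simp add: adjacent_def Int_commute)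
        have ne: "l \<noteq> B" "l \<noteq> E" "B \<noteq> E" using False Bl(2) by auto
        have "star_triangle {l, B, E}" "\<Inter>{l, B, E} = l \<inter> B"
          by (rule star_triangleI[OF lev Bl(1) E_lev ne Int_lower1 Int_lower2 LB crd])+
        moreover from this(2) have "M \<in> \<Inter>{l, B, E}" using M(1) B(4) by blast
        moreover have "Max (\<Union>{l, B, E}) = M"
        proof (rule Max_eqI)
          obtain a' c' where E': "c' \<in> l" "E = insert a' (l - {c'})" "a' < c'" using down EW False by metis
          have "c' \<le> M" using M(2) E'(1) .
          fix x assume "x \<in> \<Union>{l, B, E}"
          then have "x \<in> l \<or> x = a \<or> x = a'" using E'(2) ac(3) by auto
          then show "x \<le> M" using M(2) aM E'(3) \<open>c' \<le> M\<close> by auto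
        qed (use M(1) fin level_finite[OF Bl(1)] level_finite[OF E_lev] in auto)
        ultimately have "{l, B, E} \<in> redundant \<union> critical"
          unfolding redundant_def critical_def by blast
        moreover have "{l, B, E} \<subseteq> \<sigma>" using \<open>B \<in> \<sigma>\<close> \<open>l \<in> \<sigma>\<close> E by simp
        ultimately show False using \<sigma>(1) unfolding L0_def collapsible_part_iff by blast
      qed
      moreover have "adjacent E B"
        using cliques_adjacent[OF clique(1)[OF \<sigma>(1)] E \<open>B \<in> \<sigma>\<close>] False by simp
      ultimately show ?thesis
        using clique_dichotomy[OF lev Bl(1) E_lev adjacent_sym[OF B(3)]] EW False by (simp add: \<nu>_def)
    qed
    have w_sub: "w \<subseteq> \<nu>" by (auto simp: w)
    have "insert w \<sigma> \<in> cliques"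
    proof (rule insert_clique[OF clique(1)[OF \<sigma>(1)] w_lev])
      fix A assume "A \<in> \<sigma>" "A \<noteq> w"
      then show "adjacent A w"
        using adjacent_in_superset(1)[OF _ w_lev _ sub w_sub \<nu>(3,2)] cliques_level[OF clique(1)[OF \<sigma>(1)]] by blast
    qed
    moreover have "\<not> \<tau>' \<subseteq> insert w \<sigma>" if \<tau>': "\<tau>' \<in> redundant \<union> critical" for \<tau>'
    proof
      assume "\<tau>' \<subseteq> insert w \<sigma>"
      then have "A \<subseteq> \<nu>" if "A \<in> \<tau>'" for A using that sub w_sub by blast
      then show False using star_triangle_not_below[OF redundant_or_critical_star[OF \<tau>'] _ \<nu>(3,2)] by blast
    qed
    ultimately show "insert (\<Union>\<tau> - {M}) \<sigma> \<in> L0"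
      using clique(2)[OF \<sigma>(1)] wW unfolding L0_def collapsible_part_iff w_def[symmetric] by blast
    \<comment> \<open>Both ends of every edge in \<open>S1\<close> contain \<open>M\<close>, but the
      apex does not, so it completes no such edge.\<close>
    show "\<tau>' \<subseteq> \<sigma>" if \<tau>': "\<tau>' \<in> S1" "\<tau>' \<subseteq> insert (\<Union>\<tau> - {M}) \<sigma>" for \<tau>'
    proof -
      have "M \<in> A" if "A \<in> \<tau>'" for A using \<tau>'(1) that M(1) by (auto simp: S1_def)
      then show ?thesis using \<tau>'(2) Mw unfolding w_def[symmetric] by blast
    qed
  qed

  moreover have "collapses L1 L2"
    unfolding L2_def
  proof (rule collapses_stars[where w = "\<lambda>_. p"])
    have "S2 \<subseteq> (\<lambda>B. {l, B}) ` W" by (auto simp: S2_def)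
    then show "finite S2" using finW finite_subset by blast
    show "finite \<tau> \<and> \<tau> \<noteq> {} \<and> p \<notin> \<tau>" if "\<tau> \<in> S2" for \<tau>
      using that p(2) by (auto simp: S2_def)
    fix \<tau> \<sigma> assume \<tau>: "\<tau> \<in> S2" and \<sigma>: "\<sigma> \<in> L1" "\<tau> \<subseteq> \<sigma>"
    have \<sigma>0: "\<sigma> \<in> L0" and no_S1: "\<And>\<rho>. \<rho> \<in> S1 \<Longrightarrow> \<not> \<rho> \<subseteq> \<sigma>" using \<sigma>(1) by (auto simp: L1_def)
    have l\<sigma>: "l \<in> \<sigma>" using \<tau> \<sigma>(2) by (auto simp: S2_def)
    \<comment> \<open>With the edges of \<open>S1\<close> gone, every neighbour of \<open>l\<close>
      in \<open>\<sigma>\<close> has lost \<open>M\<close> and so arises from \<open>\<mu>\<close>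
      by adding one cell.\<close>
    have above: "\<mu> \<subseteq> E" if E: "E \<in> insert p \<sigma>" for E
    proof (cases "E = l \<or> E = p")
      case False
      then have E\<sigma>: "E \<in> \<sigma>" using E by simp
      note EW = nbr[OF \<sigma>0 l\<sigma> E\<sigma>]
      obtain a c where ac: "c \<in> l" "E = insert a (l - {c})" using down EW False by metis
      have "{l, E} \<in> S1" if "M \<in> E" using EW that False by (auto simp: S1_def)
      then have "M \<notin> E" using no_S1[of "{l, E}"] l\<sigma> E\<sigma> by blast
      then have "c = M" using ac M(1) by blast
      then show ?thesis using ac(2) by (auto simp: \<mu>_def)
    qed (use \<mu>(4) p(4) in auto)
    have ins: "insert p \<sigma> \<in> cliques"
      by (rule insert_clique_above[OF clique(1)[OF \<sigma>0] p(1) above \<mu>(3)])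
    \<comment> \<open>A forbidden triangle would contain the new vertex
      \<open>p = fill \<mu>\<close>, so it would be critical with intersection \<open>\<mu>\<close>.
      Its largest cell then lies in \<open>\<mu>\<close> and is below \<open>M\<close>, which keeps
      \<open>l\<close> out of it. Replacing \<open>p\<close> by \<open>l\<close> gives a redundant
      triangle that was already in \<open>\<sigma>\<close>.\<close>
    have no_bad: "\<not> \<rho> \<subseteq> insert p \<sigma>" if \<rho>: "\<rho> \<in> redundant \<union> critical" for \<rho>
    proof
      assume sub: "\<rho> \<subseteq> insert p \<sigma>"
      have st: "star_triangle \<rho>" using redundant_or_critical_star[OF \<rho>] .
      have I: "\<Inter>\<rho> = \<mu>" by (rule Inter_eq_of_above[OF st _ \<mu>(3)]) (use above sub in blast)
      have p\<rho>: "p \<in> \<rho>"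
        using sub \<sigma>0 \<rho> unfolding L0_def collapsible_part_iff by blast
      then have crit: "\<rho> \<in> critical" using \<rho> I by (auto simp: redundant_def p_def)
      then have Max_in: "Max (\<Union>\<rho>) \<in> \<mu>" using I by (auto simp: critical_def)
      have lev\<rho>: "\<rho> \<subseteq> level" "card \<rho> = 3" using st by (auto simp: star_triangle_def)
      have "l \<notin> \<rho>"
      proof
        assume "l \<in> \<rho>"
        then have "M \<in> \<Union>\<rho>" using M(1) by blast
        moreover have "finite (\<Union>\<rho>)"
          using star_triangle_nonempty[OF st] lev\<rho> level_finite by blast
        ultimately have "M \<le> Max (\<Union>\<rho>)" by simp
        moreover have "Max (\<Union>\<rho>) \<le> M" using M(2) Max_in \<mu>(4) by blast
        ultimately show False using Max_in \<mu>(5) by simp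
      qed
      have "card (\<rho> - {p}) = 2" using p\<rho> lev\<rho> star_triangle_nonempty[OF st] by simp
      then obtain P Q where eq: "\<rho> - {p} = {P, Q}" and ne: "P \<noteq> Q" unfolding card_2_iff by blast
      then have PQ: "P \<in> \<rho>" "Q \<in> \<rho>" "P \<noteq> p" "Q \<noteq> p" by (blast dest: equalityD2)+
      then have "P \<in> level" "Q \<in> level" "P \<noteq> l" "Q \<noteq> l" "\<mu> \<subseteq> P" "\<mu> \<subseteq> Q"
        using lev\<rho>(1) \<open>l \<notin> \<rho>\<close> I by auto
      then have "star_triangle {P, Q, l}" "\<Inter>{P, Q, l} = \<mu>"
        using star_triangleI[of P Q l \<mu>] lev ne \<mu>(3,4) by simp_all
      then have "{P, Q, l} \<in> redundant" using PQ(3,4) p(2) by (auto simp: redundant_def p_def)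
      moreover have "{P, Q, l} \<subseteq> \<sigma>" using PQ sub l\<sigma> by blast
      ultimately show False using \<sigma>0 unfolding L0_def collapsible_part_iff by blast
    qed
    have "insert p \<sigma> \<in> L0"
      using ins no_bad clique(2)[OF \<sigma>0] pW unfolding L0_def collapsible_part_iff by blast
    moreover have "\<not> \<rho> \<subseteq> insert p \<sigma>" if \<rho>: "\<rho> \<in> S1" for \<rho>
    proof -
      have "M \<in> A" if "A \<in> \<rho>" for A using \<rho> that M(1) by (auto simp: S1_def)
      then show ?thesis using no_S1[OF \<rho>] p(3) by blast
    qed
    ultimately show "insert p \<sigma> \<in> L1" by (simp add: L1_def)
    show "\<tau>' \<subseteq> \<sigma>" if "\<tau>' \<in> S2" "\<tau>' \<subseteq> insert p \<sigma>" for \<tau>'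
      using that p(2) by (auto simp: S2_def)
  qed

  moreover have "collapses L2 {\<sigma> \<in> L2. \<not> {l} \<subseteq> \<sigma>}"
  proof (rule collapses_star[where w = p])
    fix \<sigma> assume \<sigma>: "\<sigma> \<in> L2" "{l} \<subseteq> \<sigma>"
    then have \<sigma>0: "\<sigma> \<in> L0" and no_S: "\<And>\<rho>. \<rho> \<in> S1 \<union> S2 \<Longrightarrow> \<not> \<rho> \<subseteq> \<sigma>"
      by (auto simp: L1_def L2_def)
    \<comment> \<open>All other edges at \<open>l\<close> have been removed, so the only possible
      simplices through \<open>l\<close> are \<open>{l}\<close> and \<open>{l, p}\<close>.\<close>
    have "E = p" if E: "E \<in> \<sigma>" "E \<noteq> l" for E
    proof (rule ccontr)
      assume "E \<noteq> p"
      have "E \<in> W" "adjacent E l" using nbr[OF \<sigma>0 _ E] \<sigma>(2) by auto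
      then have "{l, E} \<in> S1 \<union> S2" using \<open>E \<noteq> p\<close> by (auto simp: S1_def S2_def)
      then show False using no_S[of "{l, E}"] \<sigma>(2) E(1) by blast
    qed
    then have eq: "insert p \<sigma> = {l, p}" using \<sigma>(2) by blast
    have "{l, p} \<in> cliques"
      using lev p(1) lp adjacent_sym[OF lp] by (auto simp: cliques_def)
    moreover have "\<not> \<tau> \<subseteq> {l, p}" if \<tau>: "\<tau> \<in> redundant \<union> critical" for \<tau>
    proof
      assume "\<tau> \<subseteq> {l, p}"
      then have "card \<tau> \<le> card {l, p}" by (intro card_mono) simp_all
      also have "\<dots> \<le> 2" by (simp add: card_insert_if)
      finally show False using redundant_or_critical_star[OF \<tau>] by (simp add: star_triangle_def)
    qed
    ultimately have "{l, p} \<in> L0"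
      using l(1) pW unfolding L0_def collapsible_part_iff by blast
    moreover have "\<not> \<tau> \<subseteq> {l, p}" if "\<tau> \<in> S1 \<union> S2" for \<tau>
      using that p(3) by (auto simp: S1_def S2_def adjacent_def)
    ultimately show "insert p \<sigma> \<in> L2" unfolding eq by (simp add: L1_def L2_def)
  qed (use p(2) in auto)

  moreover have "{\<sigma> \<in> L2. \<not> {l} \<subseteq> \<sigma>} = collapsible_part (W - {l})"
  proof -
    \<comment> \<open>The edges in \<open>S1\<close> and \<open>S2\<close> all contain
      \<open>l\<close>, so exactly the simplices through \<open>l\<close> have been removed by the
      three rounds.\<close>
    have "l \<in> \<rho>" if "\<rho> \<in> S1 \<union> S2" for \<rho> using that by (auto simp: S1_def S2_def)
    then show ?thesis unfolding L2_def L1_def L0_def collapsible_part_def by blast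
  qed
  ultimately show ?thesis unfolding L0_def[symmetric] by (metis collapses_trans)
qed

section \<open>Descent to the root and the count of critical triangles\<close>

lemma root_ideal: "{..<k} \<in> \<I>"
proof (induction k)
  case (Suc k)
  have "(LEAST a. a \<notin> {..<k}) = k" by (rule Least_equality) auto
  then show ?case using fill_ideal[OF Suc] by (simp add: fill_def lessThan_Suc)
qed (simp add: empty_ideal)

lemma root_level: "{..<n} \<in> level"
  by (rule levelI[OF root_ideal]) simp

text \<open>The vertices other than the root are removed by decreasing cell sum, so that the
  neighbours still present of the next one, \<open>l\<close>, are all lower. Equal sums cannot occur
  along an edge, and a neighbouring root is lower because the exchange brings in a cell below
  \<open>n\<close> for one that is not. The last hypothesis keeps the apexes of the collapses
  available.\<close>

lemma collapses_to_root:
  assumes "W \<subseteq> level" "{..<n} \<in> W"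
    and "\<And>l A. l \<in> W \<Longrightarrow> l \<noteq> {..<n} \<Longrightarrow> A \<in> level \<Longrightarrow> \<Sum>A < \<Sum>l \<Longrightarrow> A \<in> W"
  shows "collapses (collapsible_part W) {{{..<n}}}"
  using assms
proof (induction "card W" arbitrary: W rule: less_induct)
  case less
  note W = less.prems(1,2) and closed = less.prems(3)
  have finW: "finite W" using finite_subset[OF W(1) finite_vertices] .
  show ?case
  proof (cases "W = {{..<n}}")
    case True
    have "{{..<n}} \<in> collapsible_part W"
    proof -
      have "\<not> \<tau> \<subseteq> {{..<n}}" if \<tau>: "\<tau> \<in> redundant \<union> critical" for \<tau>
      proof
        assume "\<tau> \<subseteq> {{..<n}}"
        then have "card \<tau> \<le> 1" using card_mono[of "{{..<n}}" \<tau>] by simp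
        then show False using redundant_or_critical_star[OF \<tau>] by (simp add: star_triangle_def)
      qed
      then show ?thesis
        using root_level by (simp add: collapsible_part_iff cliques_def True)
    qed
    moreover have "\<sigma> = {{..<n}}" if "\<sigma> \<in> collapsible_part W" for \<sigma>
      using that by (auto simp: collapsible_part_iff cliques_def True)
    ultimately have "collapsible_part W = {{{..<n}}}" by blast
    then show ?thesis by (simp add: collapses_refl)
  next
    case False
    then have ne: "W - {{..<n}} \<noteq> {}" using W(2) by blast
    have "finite (Sum ` (W - {{..<n}}))" "Sum ` (W - {{..<n}}) \<noteq> {}" using finW ne by auto
    then obtain l where l: "l \<in> W - {{..<n}}" "\<Sum>l = Max (Sum ` (W - {{..<n}}))"
      using Max_in by (metis (no_types, lifting) imageE)
    have max: "\<Sum>B \<le> \<Sum>l" if "B \<in> W" "B \<noteq> {..<n}" for B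
      unfolding l(2) by (rule Max_ge) (use finW that in auto)
    have lev: "l \<in> level" using l W by blast
    have "collapses (collapsible_part W) (collapsible_part (W - {l}))"
    proof (rule collapse_vertex[OF W(1)])
      fix B assume B: "B \<in> W" "adjacent B l"
      obtain a c where ac: "c \<in> l" "a \<notin> l" "B = insert a (l - {c})"
        using adjacent_swap[OF lev _ B(2)] W B(1) by blast
      note sw = sum_swap_less[OF level_finite[OF lev] ac(1,2)]
      have "a \<noteq> c" using ac by blast
      show "\<Sum>B < \<Sum>l"
      proof (cases "B = {..<n}")
        case True
        have "a \<in> B" "c \<notin> B" using ac(3) \<open>a \<noteq> c\<close> by simp_all
        then have "a < c" unfolding True by simp
        then show ?thesis unfolding ac(3) sw(1) .
      next
        case False
        have "\<Sum>B \<noteq> \<Sum>l" unfolding ac(3) sw(2) by (rule \<open>a \<noteq> c\<close>)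
        then show ?thesis using max[OF B(1) False] by simp
      qed
    next
      show "A \<in> W" if "A \<in> level" "\<Sum>A < \<Sum>l" for A
        using closed[of l A] l(1) that by blast
    qed (use l(1) in blast)+
    moreover have "collapses (collapsible_part (W - {l})) {{{..<n}}}"
    proof (rule less.hyps)
      show "card (W - {l}) < card W" using finW l by (intro psubset_card_mono) auto
      \<comment> \<open>Since \<open>l\<close> has the largest sum, a vertex strictly below some
        \<open>l'\<close> differs from \<open>l\<close>.\<close>
      show "A \<in> W - {l}" if "l' \<in> W - {l}" "l' \<noteq> {..<n}" "A \<in> level" "\<Sum>A < \<Sum>l'" for l' A
        using closed[of l' A] max[of l'] that by auto
    qed (use W l in auto)
    ultimately show ?thesis by (rule collapses_trans)
  qed
qed

theorem cliques_homotopy_equivalent_wedge: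
  "\<exists>b. int b = euler_characteristic cliques - 1 \<and>
       geometric_realization cliques homotopy_equivalent_space wedge_of_2_spheres b"
proof -
  interpret facets: triangle_facets thin_cliques critical by (rule triangle_facets_thin)
  have thin: "finite thin_cliques" "euler_characteristic cliques = euler_characteristic thin_cliques"
    "geometric_realization cliques homotopy_equivalent_space geometric_realization thin_cliques"
    using collapses_thin complex_cliques finite_cliques by (simp_all add: collapses_def)
  let ?C = "thin_cliques - critical"
  have "collapsible_part level = ?C"
    by (auto simp: collapsible_part_def thin_cliques_def cliques_def)
  moreover have "collapses (collapsible_part level) {{{..<n}}}"
    using root_level by (intro collapses_to_root) auto
  ultimately have C: "euler_characteristic ?C = euler_characteristic {{{..<n}}}"
    "geometric_realization ?C homotopy_equivalent_space geometric_realization {{{..<n}}}"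
    using facets.complex_rest thin(1) by (simp_all add: collapses_def)
  have "contractible_space (geometric_realization {{v}})" for v :: "nat set"
    unfolding contractible_space_def
  proof (intro exI homotopic_with_equal)
    let ?e = "\<lambda>w. if w = v then 1 else (0::real)"
    show "id x = ?e" if "x \<in> topspace (geometric_realization {{v}})" for x
    proof -
      have "{w. x w \<noteq> 0} = {v}" "sum x {w. x w \<noteq> 0} = 1"
        using that by (auto simp: realization_points_def)
      then have "x v = 1" "\<And>w. w \<noteq> v \<Longrightarrow> x w = 0" by auto
      then show ?thesis by auto
    qed
  qed auto
  then have "contractible_space (geometric_realization ?C)"
    using homotopy_equivalent_space_contractibility[OF C(2)] by blast
  \<comment> \<open>The Euler characteristic tells the two cases apart: it is 1 for the vertex and 0
    for the empty complex.\<close>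
  moreover have "?C \<noteq> {}"
  proof
    assume "?C = {}"
    then show False using C(1) unfolding \<open>?C = {}\<close> by (simp add: euler_characteristic_def)
  qed
  ultimately have "geometric_realization thin_cliques homotopy_equivalent_space wedge_of_2_spheres (card critical)"
    by (rule facets.homotopy_equivalent_wedge)
  then have "geometric_realization cliques homotopy_equivalent_space wedge_of_2_spheres (card critical)"
    using thin(3) homotopy_eqv_trans by blast
  \<comment> \<open>The contractible part contributes 1, and each critical triangle, being of even
    dimension, contributes 1 more.\<close>
  moreover have "int (card critical) = euler_characteristic cliques - 1"
  proof -
    have "euler_characteristic thin_cliques = euler_characteristic ?C + euler_characteristic critical"
      unfolding euler_characteristic_def
      using sum.subset_diff[OF facets.facets_subset thin(1)] by blast
    moreover have "euler_characteristic critical = int (card critical)"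
      unfolding euler_characteristic_def using facets.card_facet by simp
    moreover have "euler_characteristic {{{..<n}}} = 1" by (simp add: euler_characteristic_def)
    ultimately show ?thesis using thin(2) C(1) by simp
  qed
  ultimately show ?thesis by blast
qed

end

section \<open>From partitions to order ideals\<close>

text \<open>Relabelling acts by composing barycentric coordinates with \<open>g\<close>. The lemma
  gives only one direction so that it can be applied both to a relabelling and to its
  inverse.\<close>

lemma pullback_realization:
  assumes g: "bij_betw g U V" and K: "\<And>\<sigma>. \<sigma> \<in> K \<Longrightarrow> \<sigma> \<subseteq> U"
  shows "continuous_map (geometric_realization ((`) g ` K)) (geometric_realization K)
           (\<lambda>y u. if u \<in> U then y (g u) else 0)"
  unfolding continuous_map_into_realization
proof (intro conjI allI)
  fix v
  show "continuous_map (geometric_realization ((`) g ` K)) euclideanreal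
          (\<lambda>y. if v \<in> U then y (g v) else 0)"
    by (intro continuous_map_if_const continuous_map_coordinate) simp
next
  have "(\<lambda>u. if u \<in> U then y (g u) else 0) \<in> realization_points K"
    if y: "y \<in> realization_points ((`) g ` K)" for y
  proof -
    obtain \<sigma> where \<sigma>: "\<sigma> \<in> K" "{w. y w \<noteq> 0} = g ` \<sigma>"
      using y by (auto simp: realization_points_def)
    have inj: "inj_on g U" using g by (rule bij_betw_imp_inj_on)
    have mem: "g u \<in> g ` \<sigma> \<longleftrightarrow> u \<in> \<sigma>" if "u \<in> U" for u
      using inj_on_image_mem_iff[OF inj that K[OF \<sigma>(1)]] .
    have supp: "{u. (if u \<in> U then y (g u) else 0) \<noteq> 0} = \<sigma>"
      using mem K[OF \<sigma>(1)] unfolding \<sigma>(2)[symmetric] by auto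
    have "(\<Sum>u\<in>\<sigma>. if u \<in> U then y (g u) else 0) = (\<Sum>u\<in>\<sigma>. y (g u))"
      by (rule sum.cong) (use K[OF \<sigma>(1)] in auto)
    also have "\<dots> = sum y (g ` \<sigma>)"
      using inj_on_subset[OF inj K[OF \<sigma>(1)]] by (simp add: sum.reindex)
    also have "\<dots> = 1" using y unfolding \<sigma>(2)[symmetric] by (simp add: realization_points_def)
    finally have sum1: "(\<Sum>u\<in>\<sigma>. if u \<in> U then y (g u) else 0) = 1" .
    have "0 \<le> (if u \<in> U then y (g u) else 0)" for u
      using y by (simp add: realization_points_def)
    then show ?thesis
      unfolding realization_points_def mem_Collect_eq supp using \<sigma>(1) sum1 by blast
  qed
  then show "(\<lambda>y u. if u \<in> U then y (g u) else 0)
      \<in> topspace (geometric_realization ((`) g ` K)) \<rightarrow> realization_points K"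
    by simp
qed

lemma relabel_homotopy_equivalent:
  assumes f: "inj_on f V" and K: "\<And>\<sigma>. \<sigma> \<in> K \<Longrightarrow> \<sigma> \<subseteq> V"
  shows "geometric_realization K homotopy_equivalent_space geometric_realization ((`) f ` K)"
proof -
  let ?K' = "(`) f ` K" and ?g = "inv_into V f"
  let ?F = "\<lambda>x w. if w \<in> f ` V then x (?g w) else (0::real)"
  let ?G = "\<lambda>y v. if v \<in> V then y (f v) else (0::real)"
  have fV: "bij_betw f V (f ` V)" using f by (rule inj_on_imp_bij_betw)
  have gV: "bij_betw ?g (f ` V) V" using fV by (rule bij_betw_inv_into)
  have K': "\<tau> \<subseteq> f ` V" if "\<tau> \<in> ?K'" for \<tau> using that K by blast
  have "?g ` f ` \<sigma> = \<sigma>" if "\<sigma> \<in> K" for \<sigma>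
    using K[OF that] f by (rule inv_into_image_cancel[rotated])
  then have roundtrip: "(`) ?g ` ?K' = K" by (auto simp: image_iff)
  have F: "continuous_map (geometric_realization K) (geometric_realization ?K') ?F"
    using pullback_realization[OF gV, of ?K', OF K'] unfolding roundtrip .
  have G: "continuous_map (geometric_realization ?K') (geometric_realization K) ?G"
    by (rule pullback_realization[OF fV K])
  have GF: "?G (?F x) = x" if "x \<in> realization_points K" for x
  proof
    fix v
    have "{v. x v \<noteq> 0} \<subseteq> V" using that K by (auto simp: realization_points_def)
    then show "?G (?F x) v = x v" using f by auto
  qed
  have FG: "?F (?G y) = y" if "y \<in> realization_points ?K'" for y
  proof
    fix w
    have "{w. y w \<noteq> 0} \<subseteq> f ` V" using that K' by (auto simp: realization_points_def)
    then show "?F (?G y) w = y w" by (auto simp: f_inv_into_f inv_into_into)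
  qed
  have "homeomorphic_maps (geometric_realization K) (geometric_realization ?K') ?F ?G"
    unfolding homeomorphic_maps_def using F G GF FG by simp
  then show ?thesis
    using homeomorphic_imp_homotopy_equivalent_space homeomorphic_space_def by blast
qed

lemma euler_characteristic_relabel:
  assumes f: "inj_on f V" and K: "\<And>\<sigma>. \<sigma> \<in> K \<Longrightarrow> \<sigma> \<subseteq> V"
  shows "euler_characteristic ((`) f ` K) = euler_characteristic K"
proof -
  have "inj_on ((`) f) K"
    using inj_on_image_Pow[OF f] by (rule inj_on_subset) (use K in blast)
  then have "euler_characteristic ((`) f ` K) = (\<Sum>\<sigma>\<in>K. (-1) ^ (card (f ` \<sigma>) - 1))"
    unfolding euler_characteristic_def by (simp add: sum.reindex)
  also have "\<dots> = euler_characteristic K"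
    unfolding euler_characteristic_def
    by (rule sum.cong[OF refl]) (simp add: card_image[OF inj_on_subset[OF f K]])
  finally show ?thesis .
qed

section \<open>Ferrers diagrams as order ideals of cells\<close>

definition order_ideals :: "nat set set" where
  "order_ideals = {A. finite A \<and> (\<forall>r s r' s'. prod_encode (r, s) \<in> A \<longrightarrow> r' \<le> r \<longrightarrow> s' \<le> s \<longrightarrow>
     prod_encode (r', s') \<in> A)}"

lemma order_idealsD:
  "A \<in> order_ideals \<Longrightarrow> prod_encode (r, s) \<in> A \<Longrightarrow> r' \<le> r \<Longrightarrow> s' \<le> s \<Longrightarrow> prod_encode (r', s') \<in> A"
  unfolding order_ideals_def by blast

lemma order_idealsI:
  "finite A \<Longrightarrow> (\<And>r s r' s'. prod_encode (r, s) \<in> A \<Longrightarrow> r' \<le> r \<Longrightarrow> s' \<le> s \<Longrightarrow> prod_encode (r', s') \<in> A) \<Longrightarrow>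
     A \<in> order_ideals"
  unfolding order_ideals_def by blast

lemma prod_encode_mono:
  assumes "r' \<le> r" "s' \<le> s" shows "prod_encode (r', s') \<le> prod_encode (r, s)"
proof -
  have "triangle (r' + s') \<le> triangle (r + s)"
    unfolding triangle_def using assms by (intro div_le_mono mult_le_mono) auto
  then show ?thesis using assms by (simp add: prod_encode_def)
qed

lemma ideal_family_order_ideals:
  assumes "finite {A \<in> order_ideals. card A = n}"
  shows "ideal_family order_ideals n"
proof
  show "{} \<in> order_ideals" "\<And>A. A \<in> order_ideals \<Longrightarrow> finite A" by (auto simp: order_ideals_def)
  show "A \<inter> B \<in> order_ideals" "A \<union> B \<in> order_ideals" if "A \<in> order_ideals" "B \<in> order_ideals" for A B
    using that unfolding order_ideals_def by blast+
  show "A - {Max A} \<in> order_ideals" if A: "A \<in> order_ideals" "A \<noteq> {}" for A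
  proof (rule order_idealsI)
    show "finite (A - {Max A})" using A(1) by (simp add: order_ideals_def)
    fix r s r' s' assume rs: "prod_encode (r, s) \<in> A - {Max A}" "r' \<le> r" "s' \<le> s"
    then have "prod_encode (r, s) < Max A"
      using A(1) by (simp add: order_ideals_def order_less_le)
    then have "prod_encode (r', s') < Max A"
      using prod_encode_mono[OF rs(2,3)] by simp
    then show "prod_encode (r', s') \<in> A - {Max A}"
      using order_idealsD[OF A(1) _ rs(2,3)] rs(1) by simp
  qed
  show "fill A \<in> order_ideals" if A: "A \<in> order_ideals" for A
  proof (rule order_idealsI)
    show "finite (fill A)" using A by (simp add: fill_def order_ideals_def)
    fix r s r' s' assume rs: "prod_encode (r, s) \<in> fill A" "r' \<le> r" "s' \<le> s"
    show "prod_encode (r', s') \<in> fill A"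
    proof (cases "prod_encode (r, s) \<in> A")
      case True
      then show ?thesis using order_idealsD[OF A True rs(2,3)] by (simp add: fill_def)
    next
      case False
      then have "prod_encode (r, s) = (LEAST a. a \<notin> A)" using rs(1) by (simp add: fill_def)
      then have "prod_encode (r', s') \<le> (LEAST a. a \<notin> A)" using prod_encode_mono[OF rs(2,3)] by simp
      then show ?thesis
        using not_less_Least[of "prod_encode (r', s')" "\<lambda>a. a \<notin> A"] unfolding fill_def
        by (cases "prod_encode (r', s') = (LEAST a. a \<notin> A)") auto
    qed
  qed
  show "finite {A \<in> order_ideals. card A = n}" by (rule assms)
qed

text \<open>The parts of the conjugate partition, with columns indexed from 0. Diagrams are
  described by columns because these heights ignore the order of the rows and rows of length 0, so
  the sorting and filtering in \<open>move_cell\<close> become invisible.\<close>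

definition column_height :: "nat list \<Rightarrow> nat \<Rightarrow> nat" where
  "column_height xs s = length (filter (\<lambda>k. s < k) xs)"

definition cells :: "nat list \<Rightarrow> nat set" where
  "cells xs = {prod_encode (r, s) |r s. r < column_height xs s}"

lemma mem_cells [simp]: "prod_encode (r, s) \<in> cells xs \<longleftrightarrow> r < column_height xs s"
  by (auto simp: cells_def)

lemma cells_eqI: "(\<And>r s. prod_encode (r, s) \<in> A \<longleftrightarrow> prod_encode (r, s) \<in> B) \<Longrightarrow> A = B"
  by (metis prod_decode_inverse subsetI subset_antisym surj_pair)

lemma column_antimono: "s \<le> t \<Longrightarrow> column_height xs t \<le> column_height xs s"
  by (induction xs) (auto simp: column_height_def)

lemma sum_column: "(\<And>k. k \<in> set xs \<Longrightarrow> k \<le> N) \<Longrightarrow> (\<Sum>s<N. column_height xs s) = sum_list xs"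
proof (induction xs)
  case (Cons k xs)
  have "column_height (k # xs) s = (if s < k then 1 else 0) + column_height xs s" for s
    by (simp add: column_height_def)
  then have "(\<Sum>s<N. column_height (k # xs) s) = (\<Sum>s<N. if s < k then 1 else 0) + (\<Sum>s<N. column_height xs s)"
    by (simp add: sum.distrib)
  also have "(\<Sum>s<N. if s < k then 1 else 0) = card ({..<N} \<inter> {..<k})"
    by (simp add: sum.If_cases lessThan_def Collect_conj_eq)
  also have "{..<N} \<inter> {..<k} = {..<k}" using Cons.prems[of k] by auto
  finally show ?case using Cons by simp
qed (simp add: column_height_def)

lemma cells_finite_card: "finite (cells xs)" "card (cells xs) = sum_list xs"
proof -
  define N where "N = sum_list xs"
  have N: "k \<le> N" if "k \<in> set xs" for k using member_le_sum_list[OF that] by (simp add: N_def)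
  then have "column_height xs s = 0" if "N \<le> s" for s
    using that unfolding column_height_def by (fastforce simp: filter_empty_conv)
  then have "r < column_height xs s \<Longrightarrow> s < N" for r s by (metis not_less less_nat_zero_code)
  then have eq: "cells xs = (\<lambda>(s, r). prod_encode (r, s)) ` (SIGMA s:{..<N}. {..<column_height xs s})"
    by (force simp: cells_def)
  show "finite (cells xs)" unfolding eq by simp
  have "card (cells xs) = card (SIGMA s:{..<N}. {..<column_height xs s})"
    unfolding eq by (rule card_image) (auto simp: inj_on_def prod_encode_eq)
  also have "\<dots> = (\<Sum>s<N. column_height xs s)" by simp
  also have "\<dots> = sum_list xs" using sum_column N by blast
  finally show "card (cells xs) = sum_list xs" .
qed

lemma cells_order_ideal: "cells xs \<in> order_ideals"
proof (rule order_idealsI)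
  fix r s r' s' assume "prod_encode (r, s) \<in> cells xs" "r' \<le> r" "s' \<le> s"
  then show "prod_encode (r', s') \<in> cells xs"
    using column_antimono[of s' s xs] by simp
qed (rule cells_finite_card)

text \<open>Recovers the multiplicity of each positive row length from the column heights. It gives
  injectivity of \<open>cells\<close> and, later, the existence of rows of a prescribed
  length.\<close>

lemma column_Suc: "card {i. i < length xs \<and> xs ! i = Suc t} + column_height xs (Suc t) = column_height xs t"
proof -
  have "column_height xs t = card {i. i < length xs \<and> t < xs ! i}" for t
    by (simp add: column_height_def length_filter_conv_card)
  moreover have "{i. i < length xs \<and> t < xs ! i} =
      {i. i < length xs \<and> xs ! i = Suc t} \<union> {i. i < length xs \<and> Suc t < xs ! i}"
    by auto
  moreover have "card ({i. i < length xs \<and> xs ! i = Suc t} \<union> {i. i < length xs \<and> Suc t < xs ! i}) =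
      card {i. i < length xs \<and> xs ! i = Suc t} + card {i. i < length xs \<and> Suc t < xs ! i}"
    by (rule card_Un_disjoint) auto
  ultimately show ?thesis by simp
qed

text \<open>The heights determine the multiplicity of every positive row length, and a sorted list
  is determined by its multiset.\<close>

lemma column_inj:
  assumes xs: "sorted_wrt (\<ge>) xs" "\<forall>k\<in>set xs. 0 < k" and ys: "sorted_wrt (\<ge>) ys" "\<forall>k\<in>set ys. 0 < k"
    and eq: "\<And>s. column_height xs s = column_height ys s"
  shows "xs = ys"
proof -
  have "count (mset xs) k = count (mset ys) k" for k
  proof (cases k)
    case 0
    then show ?thesis using xs(2) ys(2) by (metis count_mset_0_iff less_irrefl)
  next
    case (Suc t)
    have "count (mset zs) k = card {i. i < length zs \<and> zs ! i = Suc t}" for zs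
      unfolding Suc count_mset by (simp add: count_list_eq_length_filter length_filter_conv_card eq_commute)
    then show ?thesis using column_Suc[of xs t] column_Suc[of ys t] eq by simp
  qed
  then have "mset (rev xs) = mset (rev ys)" by (simp add: multiset_eq_iff)
  moreover have "sorted (rev xs)" "sorted (rev ys)" using xs(1) ys(1) by (simp_all add: sorted_wrt_rev)
  ultimately have "rev xs = rev ys" by (metis properties_for_sort)
  then show ?thesis by simp
qed

lemma cells_eq_iff_column: "cells xs = cells ys \<longleftrightarrow> (\<forall>s. column_height xs s = column_height ys s)"
proof
  assume eq: "cells xs = cells ys"
  have "r < column_height xs s \<longleftrightarrow> r < column_height ys s" for r s
    using eq mem_cells by metis
  then show "\<forall>s. column_height xs s = column_height ys s" by (metis linorder_neqE_nat less_irrefl)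
qed (simp add: cells_def)

lemma inj_on_cells: "inj_on cells (partitions n)"
  by (intro inj_onI column_inj) (auto simp: partitions_def cells_eq_iff_column)

lemma mem_initial_segment:
  fixes S :: "nat set"
  assumes "finite S" "\<And>x y. x \<in> S \<Longrightarrow> y \<le> x \<Longrightarrow> y \<in> S"
  shows "x \<in> S \<longleftrightarrow> x < card S"
proof -
  define m where "m = (LEAST x. x \<notin> S)"
  have "\<exists>x. x \<notin> S" using ex_new_if_finite[OF infinite_UNIV_nat assms(1)] .
  then have "m \<notin> S" unfolding m_def by (rule LeastI_ex)
  then have "S = {..<m}" using not_less_Least[of _ "\<lambda>x. x \<notin> S"] assms(2) unfolding m_def
    by (metis (mono_tags, lifting) lessThan_iff linorder_not_less subsetI subset_antisym)
  then show ?thesis by simp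
qed

text \<open>For surjectivity, every row and every column of an ideal is an initial segment and thus
  determined by its size; the nonempty rows are the first \<open>h\<close>, where \<open>h\<close>
  is the size of column 0.\<close>

lemma cells_partitions: "cells ` partitions n = {A \<in> order_ideals. card A = n}"
proof (intro equalityI subsetI)
  fix A assume "A \<in> cells ` partitions n"
  then show "A \<in> {A \<in> order_ideals. card A = n}"
    by (auto simp: cells_order_ideal cells_finite_card partitions_def)
next
  fix A assume "A \<in> {A \<in> order_ideals. card A = n}"
  then have A: "A \<in> order_ideals" "card A = n" "finite A" by (auto simp: order_ideals_def)
  have fin: "finite {s. prod_encode (r, s) \<in> A}" "finite {r. prod_encode (r, s) \<in> A}" for r s
    using A(3) by (auto intro!: finite_vimageI[where h = "\<lambda>s. prod_encode (r, s)", unfolded vimage_def]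
        finite_vimageI[where h = "\<lambda>r. prod_encode (r, s)", unfolded vimage_def] simp: inj_def prod_encode_eq)
  define row where "row r = card {s. prod_encode (r, s) \<in> A}" for r
  define h where "h = card {r. prod_encode (r, 0) \<in> A}"
  have row: "prod_encode (r, s) \<in> A \<longleftrightarrow> s < row r" for r s
    using mem_initial_segment[OF fin(1), of r s] order_idealsD[OF A(1)] unfolding row_def by blast
  have col: "prod_encode (r, s) \<in> A \<longleftrightarrow> r < card {r. prod_encode (r, s) \<in> A}" for r s
    using mem_initial_segment[OF fin(2), of s r] order_idealsD[OF A(1)] by blast
  have h: "r < h \<longleftrightarrow> 0 < row r" for r using col[of r 0] row[of r 0] by (simp add: h_def)
  define xs where "xs = map row [0..<h]"
  have height: "column_height xs s = card {r. prod_encode (r, s) \<in> A}" for s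
  proof -
    have "column_height xs s = card {r. r < h \<and> s < row r}"
      by (simp add: column_height_def xs_def length_filter_conv_card cong: conj_cong)
    also have "{r. r < h \<and> s < row r} = {r. prod_encode (r, s) \<in> A}"
      using h row by auto
    finally show ?thesis .
  qed
  have cells: "cells xs = A"
    by (rule cells_eqI) (unfold mem_cells height, rule col[symmetric])
  moreover have "xs \<in> partitions n"
  proof -
    have "row r' \<le> row r" if "r \<le> r'" for r r'
    proof (rule ccontr)
      assume "\<not> row r' \<le> row r"
      then have "prod_encode (r', row r) \<in> A" by (simp add: row)
      then have "prod_encode (r, row r) \<in> A" using order_idealsD[OF A(1)] that by blast
      then show False by (simp add: row)
    qed
    then have "sorted_wrt (\<ge>) xs" by (simp add: xs_def sorted_wrt_iff_nth_less)
    moreover have "\<forall>k\<in>set xs. 0 < k" using h by (auto simp: xs_def)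
    moreover have "sum_list xs = n" using cells_finite_card(2)[of xs] cells A(2) by simp
    ultimately show ?thesis by (simp add: partitions_def)
  qed
  ultimately show "A \<in> cells ` partitions n" by blast
qed

section \<open>Moving a cell in terms of column heights\<close>

lemma column_list_update:
  "i < length zs \<Longrightarrow> column_height (zs[i := v]) s + of_bool (s < zs ! i) = column_height zs s + of_bool (s < v)"
proof (induction zs arbitrary: i)
  case (Cons z zs)
  then show ?case by (cases i) (auto simp: column_height_def)
qed simp

lemma column_mset: "mset xs = mset ys \<Longrightarrow> column_height xs s = column_height ys s"
  unfolding column_height_def by (metis mset_filter size_mset)

text \<open>The cell taken away is the last one of row \<open>i\<close>, in column
  \<open>xs ! i - 1\<close>; the new cell goes just behind row \<open>j\<close>, in column
  \<open>(xs @ [0]) ! j\<close>, with length 0 for a new row. Adding on both sides avoids truncated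
  subtraction.\<close>

lemma column_move_cell:
  assumes "i < length xs" "j \<le> length xs" "i \<noteq> j" "0 < xs ! i"
  shows "column_height (move_cell xs i j) s + of_bool (s = xs ! i - 1) =
         column_height xs s + of_bool (s = (xs @ [0]) ! j)"
proof -
  let ?ys = "xs @ [0]"
  let ?p = "?ys ! i" and ?q = "?ys ! j"
  let ?zs = "?ys[i := ?p - 1, j := ?q + 1]"
  have p: "?p = xs ! i" using assms by (simp add: nth_append)
  have "column_height (move_cell xs i j) s = column_height (filter (\<lambda>k. 0 < k) ?zs) s"
    unfolding move_cell_def Let_def by (rule column_mset) simp
  also have "\<dots> = column_height ?zs s"
    unfolding column_height_def filter_filter by (rule arg_cong[where f = length], rule filter_cong) auto
  finally have "column_height (move_cell xs i j) s = column_height ?zs s" .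
  moreover have "column_height ?zs s + of_bool (s < ?q) = column_height (?ys[i := ?p - 1]) s + of_bool (s < ?q + 1)"
    using column_list_update[of j "?ys[i := ?p - 1]" "?q + 1" s] assms by simp
  moreover have "column_height (?ys[i := ?p - 1]) s + of_bool (s < ?p) = column_height ?ys s + of_bool (s < ?p - 1)"
    using column_list_update[of i ?ys "?p - 1" s] assms by simp
  moreover have "column_height ?ys s = column_height xs s" by (simp add: column_height_def)
  moreover have "(of_bool (s < ?q + 1) :: nat) = of_bool (s < ?q) + of_bool (s = ?q)"
    "(of_bool (s < ?p) :: nat) = of_bool (s < ?p - 1) + of_bool (s = ?p - 1)"
    using assms(4) p by (auto simp: of_bool_def)
  ultimately show ?thesis unfolding p by linarith
qed

lemma move_cell_sorted: "sorted_wrt (\<ge>) (move_cell xs i j)" "\<forall>k\<in>set (move_cell xs i j). 0 < k"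
  by (auto simp: move_cell_def Let_def sorted_wrt_rev)

text \<open>Column \<open>u\<close> is the only one that becomes shorter, by one, so the cell at its
  end is the only cell of \<open>xs\<close> that \<open>ys\<close> lacks.\<close>

lemma card_cells_Int:
  assumes "u \<noteq> v" and col: "\<And>s. column_height ys s + of_bool (s = u) = column_height xs s + of_bool (s = v)"
  shows "Suc (card (cells xs \<inter> cells ys)) = sum_list xs"
proof -
  let ?c = "prod_encode (column_height ys u, u)"
  have "column_height xs u = Suc (column_height ys u)" using col[of u] assms(1) by simp
  moreover have "column_height ys v = Suc (column_height xs v)" using col[of v] assms(1) by simp
  moreover have "column_height ys s = column_height xs s" if "s \<noteq> u" "s \<noteq> v" for s using col[of s] that by simp
  ultimately have "r < column_height xs s \<and> r < column_height ys s \<longleftrightarrow> r < column_height xs s \<and> (r, s) \<noteq> (column_height ys u, u)" for r s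
    by (cases "s = u"; cases "s = v") auto
  then have "cells xs \<inter> cells ys = cells xs - {?c}"
    by (intro cells_eqI) (auto simp: prod_encode_eq)
  moreover have "?c \<in> cells xs" using \<open>column_height xs u = Suc (column_height ys u)\<close> by simp
  ultimately show ?thesis
    using card_Suc_Diff1[OF cells_finite_card(1)] by (simp only: cells_finite_card(2))
qed

lemma column_differ:
  assumes "cells xs - cells ys = {c}"
  obtains u where "column_height xs u = Suc (column_height ys u)" "\<And>t. t \<noteq> u \<Longrightarrow> column_height xs t \<le> column_height ys t"
proof -
  obtain r u where c: "c = prod_encode (r, u)" by (metis prod_decode_inverse surj_pair)
  have diff: "r' < column_height xs s \<and> \<not> r' < column_height ys s \<longleftrightarrow> r' = r \<and> s = u" for r' s
  proof -
    have "prod_encode (r', s) \<in> cells xs - cells ys \<longleftrightarrow> prod_encode (r', s) = c" using assms by simp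
    then show ?thesis by (simp add: c prod_encode_eq)
  qed
  show ?thesis
  proof
    show "column_height xs u = Suc (column_height ys u)"
      \<comment> \<open>The first instance shows that \<open>xs\<close> exceeds \<open>ys\<close> in
        column \<open>u\<close>; the other two identify \<open>r\<close> with both the first and the
        last row of the excess, so the excess is one cell.\<close>
      using diff[of r u] diff[of "column_height ys u" u] diff[of "column_height xs u - 1" u] by auto
    show "column_height xs t \<le> column_height ys t" if "t \<noteq> u" for t
      using diff[of "column_height ys t" t] that by auto
  qed
qed

text \<open>Sharing all but one cell means that some column \<open>u\<close> loses a cell and
  another column \<open>v\<close> gains one. To realize this as a move, \<open>xs\<close> needs a
  row of length \<open>u + 1\<close> to shorten and a different row of length \<open>v\<close> to
  lengthen. Both exist because the column heights of \<open>ys\<close> are weakly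
  decreasing.\<close>

lemma partition_edge_iff:
  assumes xs: "xs \<in> partitions n" and ys: "ys \<in> partitions n" and ne: "xs \<noteq> ys"
  shows "(\<exists>i j. i < length xs \<and> j \<le> length xs \<and> i \<noteq> j \<and> ys = move_cell xs i j) \<longleftrightarrow>
         Suc (card (cells xs \<inter> cells ys)) = n"
proof
  assume "\<exists>i j. i < length xs \<and> j \<le> length xs \<and> i \<noteq> j \<and> ys = move_cell xs i j"
  then obtain i j where ij: "i < length xs" "j \<le> length xs" "i \<noteq> j" "ys = move_cell xs i j" by blast
  have "0 < xs ! i" using xs ij(1) by (simp add: partitions_def)
  note col = column_move_cell[OF ij(1-3) this, folded ij(4)]
  \<comment> \<open>A cell moved within one column would give back the same partition.\<close>
  have "xs ! i - 1 \<noteq> (xs @ [0]) ! j"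
  proof
    assume "xs ! i - 1 = (xs @ [0]) ! j"
    then have "cells ys = cells xs" using col unfolding cells_eq_iff_column by simp
    then show False using inj_onD[OF inj_on_cells _ xs ys] ne by simp
  qed
  then show "Suc (card (cells xs \<inter> cells ys)) = n"
    using card_cells_Int[of "xs ! i - 1" "(xs @ [0]) ! j" ys xs] col xs by (simp add: partitions_def)
next
  assume n: "Suc (card (cells xs \<inter> cells ys)) = n"
  have card: "card (cells xs) = n" "card (cells ys) = n"
    using xs ys by (simp_all add: cells_finite_card partitions_def)
  have "card (cells xs - cells ys) = 1" "card (cells ys - cells xs) = 1"
    using card_Diff_subset_Int[of "cells xs" "cells ys"] card_Diff_subset_Int[of "cells ys" "cells xs"]
      cells_finite_card(1) card n by (simp_all add: Int_commute)
  then obtain c d where "cells xs - cells ys = {c}" "cells ys - cells xs = {d}"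
    by (elim card_1_singletonE)
  then obtain u v where u: "column_height xs u = Suc (column_height ys u)" "\<And>t. t \<noteq> u \<Longrightarrow> column_height xs t \<le> column_height ys t"
    and v: "column_height ys v = Suc (column_height xs v)" "\<And>t. t \<noteq> v \<Longrightarrow> column_height ys t \<le> column_height xs t"
    using column_differ by metis
  have uv: "u \<noteq> v" using u v by auto
  have rel: "column_height ys t + of_bool (t = u) = column_height xs t + of_bool (t = v)" for t
    using u(1) u(2)[of t] v(1) v(2)[of t] uv by (cases "t = u"; cases "t = v") auto
  let ?R = "\<lambda>t. {i. i < length xs \<and> xs ! i = Suc t}"
  have R: "card (?R t) + column_height xs (Suc t) = column_height xs t" for t by (rule column_Suc)
  have ys_mono: "column_height ys (Suc t) \<le> column_height ys t" for t by (rule column_antimono) simp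
  \<comment> \<open>Column \<open>u + 1\<close> of \<open>xs\<close> is at most that of
    \<open>ys\<close>, hence at most column \<open>u\<close> of \<open>ys\<close>, which is one less
    than column \<open>u\<close> of \<open>xs\<close>; the drop counts rows of length
    \<open>u + 1\<close>.\<close>
  have "0 < card (?R u)"
    using R[of u] u(1) u(2)[of "Suc u"] ys_mono[of u] by simp
  then have Ru: "?R u \<noteq> {}" by (metis card.empty less_irrefl)
  have "\<exists>i j. i < length xs \<and> j \<le> length xs \<and> i \<noteq> j \<and> xs ! i = Suc u \<and> (xs @ [0]) ! j = v"
  proof (cases v)
    case 0
    from Ru obtain i where "i \<in> ?R u" by blast
    then show ?thesis using 0 by (intro exI[of _ i] exI[of _ "length xs"]) simp
  next
    case (Suc t)
    have t: "column_height ys v \<le> column_height xs t" using ys_mono[of t] v(2)[of t] Suc by simp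
    show ?thesis
    proof (cases "t = u")
      case True
      \<comment> \<open>Here \<open>v = u + 1\<close>, so the rows to shorten and to lengthen have
        the same length, and two of them are needed. The drop from column \<open>u\<close> to column
        \<open>v\<close> is at least 2, because \<open>ys\<close> has one cell less in the former,
        one more in the latter, and still decreasing heights.\<close>
      then have "2 \<le> card (?R u)"
        using R[of u] u(1) v(1) Suc ys_mono[of u] by simp
      then obtain i j where "i \<in> ?R u" "j \<in> ?R u" "i \<noteq> j"
        using card_le_Suc0_iff_eq[of "?R u"] by force
      then show ?thesis using Suc True by (intro exI[of _ i] exI[of _ j]) (auto simp: nth_append)
    next
      case False
      have "0 < card (?R t)" using R[of t] t v(1) Suc by simp
      then have "?R t \<noteq> {}" by (metis card.empty less_irrefl)
      then obtain i j where "i \<in> ?R u" "j \<in> ?R t" using Ru by blast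
      then show ?thesis using Suc False by (intro exI[of _ i] exI[of _ j]) (auto simp: nth_append)
    qed
  qed
  then obtain i j where ij: "i < length xs" "j \<le> length xs" "i \<noteq> j" "xs ! i = Suc u" "(xs @ [0]) ! j = v"
    by blast
  have "column_height ys s = column_height (move_cell xs i j) s" for s
    using column_move_cell[OF ij(1-3), of s] rel[of s] ij(4,5) by simp
  then have "ys = move_cell xs i j"
    using ys by (intro column_inj move_cell_sorted) (auto simp: partitions_def)
  then show "\<exists>i j. i < length xs \<and> j \<le> length xs \<and> i \<noteq> j \<and> ys = move_cell xs i j"
    using ij by blast
qed

lemma mem_partition_edges:
  assumes "xs \<in> partitions n" "ys \<in> partitions n" "xs \<noteq> ys"
  shows "{xs, ys} \<in> partition_edges n \<longleftrightarrow> Suc (card (cells xs \<inter> cells ys)) = n"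
proof
  assume "{xs, ys} \<in> partition_edges n"
  then obtain xs' ys' where e: "{xs, ys} = {xs', ys'}" "xs' \<in> partitions n" "ys' \<in> partitions n" "xs' \<noteq> ys'"
    "\<exists>i j. i < length xs' \<and> j \<le> length xs' \<and> i \<noteq> j \<and> ys' = move_cell xs' i j"
    unfolding partition_edges_def by blast
  have "Suc (card (cells xs' \<inter> cells ys')) = n"
    using partition_edge_iff[OF e(2-4)] e(5) by blast
  moreover have "cells xs' \<inter> cells ys' = cells xs \<inter> cells ys"
    using e(1) by (auto simp: doubleton_eq_iff)
  ultimately show "Suc (card (cells xs \<inter> cells ys)) = n" by simp
next
  assume "Suc (card (cells xs \<inter> cells ys)) = n"
  then show "{xs, ys} \<in> partition_edges n"
    using partition_edge_iff[OF assms] assms unfolding partition_edges_def by blast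
qed

theorem theorem1p1:
  fixes n :: nat
  assumes "n \<ge> 1"
  shows "\<exists>b. int b = euler_characteristic (partition_complex n) - 1 \<and>
             geometric_realization (partition_complex n) homotopy_equivalent_space
               wedge_of_2_spheres b"
proof -
  interpret ideal_family order_ideals n
    by (rule ideal_family_order_ideals) (simp add: finite_partitions flip: cells_partitions)
  have level: "level = cells ` partitions n" by (simp add: level_def cells_partitions)
  let ?K = "partition_complex n"
  have sub: "\<sigma> \<subseteq> partitions n" if "\<sigma> \<in> ?K" for \<sigma> using that by (simp add: clique_complex_def)
  have mem: "cells ` \<sigma> \<in> cliques \<longleftrightarrow> \<sigma> \<in> ?K" if \<sigma>: "\<sigma> \<subseteq> partitions n" for \<sigma>
  proof -
    have "adjacent (cells xs) (cells ys) \<longleftrightarrow> {xs, ys} \<in> partition_edges n"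
      if "xs \<in> \<sigma>" "ys \<in> \<sigma>" "xs \<noteq> ys" for xs ys
      using mem_partition_edges[of xs n ys] that \<sigma> inj_onD[OF inj_on_cells, of xs ys n]
      unfolding adjacent_def by blast
    moreover have "cells xs \<noteq> cells ys \<longleftrightarrow> xs \<noteq> ys" if "xs \<in> \<sigma>" "ys \<in> \<sigma>" for xs ys
      using that \<sigma> inj_onD[OF inj_on_cells, of xs ys n] by blast
    moreover have "finite \<sigma>" using finite_subset[OF \<sigma> finite_partitions] .
    ultimately show ?thesis
      using \<sigma> unfolding cliques_def clique_complex_def clique_def level by (simp add: image_mono)
  qed
  have "cliques = (`) cells ` ?K"
  proof (intro equalityI subsetI)
    fix \<tau> assume \<tau>: "\<tau> \<in> cliques"
    then have "\<tau> \<subseteq> cells ` partitions n" by (simp add: cliques_def level)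
    then obtain \<sigma> where "\<sigma> \<subseteq> partitions n" "\<tau> = cells ` \<sigma>" by (auto simp: subset_image_iff)
    then show "\<tau> \<in> (`) cells ` ?K" using mem \<tau> by blast
  qed (use mem sub in blast)
  then show ?thesis
    using cliques_homotopy_equivalent_wedge relabel_homotopy_equivalent[OF inj_on_cells sub]
      euler_characteristic_relabel[OF inj_on_cells sub] homotopy_eqv_trans by metis
qed

end
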